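(* Let $Z$ be a closed subset of $X = \operatorname{Spec}(V)$, for a valuation ring $V$, and let $U = X - Z$. For a sheaf of abelian groups $\mathcal F$ on $X$, the following hold: (1) $H^i\Gamma_Z(\mathcal F) \cong H^{i-1}(U, \mathcal{F}|_U)$ for all $i>1$, and $H^1\Gamma_Z(\mathcal F) \cong \operatorname{coker}\big(\mathcal{F}(X)\xrightarrow{\operatorname{res}^X_U} \mathcal{F}(U)\big)$. (2) If $V$ has finite Krull dimension or if $U$ is quasi-compact, then $H^i\Gamma_Z(\mathcal F) = 0$ for all $i > 1$.
   Context: Rings are commutative with identity; valuation rings are not assumed Noetherian. For a topological space $X$, a closed subset $Z \subseteq X$ and $U = X - Z$, the functor $\Gamma_Z$ from sheaves of abelian groups on $X$ to abelian groups is $\Gamma_Z(\mathcal F) := \ker(\operatorname{res}^X_U : \mathcal F(X) \to \mathcal F(U))$, the global sections with support contained in $Z$. It is left exact, and its right derived functors, denoted $H^i\Gamma_Z$, are the local cohomology functors with support in $Z$. $H^{j}(U, \mathcal F|_U)$ denotes ordinary sheaf cohomology. *)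

theory Defs
  imports "HOL-Algebra.Ideal" "HOL-Algebra.Divisibility" "HOL-Algebra.Elementary_Groups"
    "HOL-Analysis.Abstract_Topology" "HOL-Library.Extended_Nat"
begin

section \<open>Valuation rings, prime spectra, Krull dimension\<close>

text \<open>
  A domain is a valuation ring if every element \<open>a / b\<close> of its fraction field, or else the inverse
  \<open>b / a\<close>, lies in the ring. Here \<open>a / b\<close> with \<open>b \<noteq> 0\<close> lies in the ring iff \<open>b\<close> divides \<open>a\<close>.
  Fields are included.
\<close>

definition valuation_ring :: "('a, 'm) ring_scheme \<Rightarrow> bool" where
  "valuation_ring R \<longleftrightarrow> domain R \<and>
     (\<forall>a\<in>carrier R. \<forall>b\<in>carrier R. a divides\<^bsub>R\<^esub> b \<or> b divides\<^bsub>R\<^esub> a)"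

definition spectrum :: "('a, 'm) ring_scheme \<Rightarrow> 'a set set" where
  "spectrum R = {P. primeideal P R}"

definition zariski_open :: "('a, 'm) ring_scheme \<Rightarrow> 'a set set \<Rightarrow> bool" where
  "zariski_open R W \<longleftrightarrow> (\<exists>E\<subseteq>carrier R. W = {P \<in> spectrum R. \<not> E \<subseteq> P})"

definition Spec :: "('a, 'm) ring_scheme \<Rightarrow> 'a set topology" where
  "Spec R = topology (zariski_open R)"

lemma istopology_zariski_open: "istopology (zariski_open R)"
  unfolding istopology_def
proof (intro conjI allI impI)
  fix S T assume "zariski_open R S" "zariski_open R T"
  then obtain E E' where E: "E \<subseteq> carrier R" "S = {P \<in> spectrum R. \<not> E \<subseteq> P}"
    and E': "E' \<subseteq> carrier R" "T = {P \<in> spectrum R. \<not> E' \<subseteq> P}"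
    by (auto simp: zariski_open_def)
  let ?EE = "{x \<otimes>\<^bsub>R\<^esub> y | x y. x \<in> E \<and> y \<in> E'}"
  have iff: "(\<not> ?EE \<subseteq> P) \<longleftrightarrow> (\<not> E \<subseteq> P \<and> \<not> E' \<subseteq> P)" if "primeideal P R" for P
  proof -
    interpret primeideal P R by fact
    have "x \<otimes>\<^bsub>R\<^esub> y \<in> P \<longleftrightarrow> x \<in> P \<or> y \<in> P" if "x \<in> E" "y \<in> E'" for x y
      using that E(1) E'(1) I_prime I_l_closed I_r_closed by blast
    then show ?thesis by blast
  qed
  have "S \<inter> T = {P \<in> spectrum R. \<not> ?EE \<subseteq> P}"
    using iff unfolding E(2) E'(2) spectrum_def by blast
  moreover have "?EE \<subseteq> carrier R" if "P \<in> S" for P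
  proof -
    interpret primeideal P R using that E(2) by (simp add: spectrum_def)
    show ?thesis using E(1) E'(1) by auto
  qed
  ultimately show "zariski_open R (S \<inter> T)"
    unfolding zariski_open_def
    by (cases "S = {}") (blast intro: exI[of _ "{}"])+
next
  fix \<K> assume "\<forall>K\<in>\<K>. zariski_open R K"
  then obtain E where E: "\<And>K. K \<in> \<K> \<Longrightarrow> E K \<subseteq> carrier R \<and> K = {P \<in> spectrum R. \<not> E K \<subseteq> P}"
    unfolding zariski_open_def by metis
  have "\<Union>\<K> = {P \<in> spectrum R. \<not> (\<Union>K\<in>\<K>. E K) \<subseteq> P}"
    using E by blast
  moreover have "(\<Union>K\<in>\<K>. E K) \<subseteq> carrier R" using E by blast
  ultimately show "zariski_open R (\<Union>\<K>)"
    unfolding zariski_open_def by blast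
qed

lemma openin_Spec: "openin (Spec R) W \<longleftrightarrow> zariski_open R W"
  by (simp add: Spec_def istopology_zariski_open topology_inverse')

lemma topspace_Spec: "topspace (Spec R) = spectrum R"
proof -
  have "{P \<in> spectrum R. \<not> carrier R \<subseteq> P} = spectrum R"
    unfolding spectrum_def
    by (auto dest: primeideal.I_notcarr primeideal.axioms(1) ideal.Icarr)
  then have "openin (Spec R) (spectrum R)"
    unfolding openin_Spec zariski_open_def by blast
  moreover have "W \<subseteq> spectrum R" if "openin (Spec R) W" for W
    using that unfolding openin_Spec zariski_open_def by blast
  ultimately show ?thesis
    by (meson openin_subset openin_topspace subset_antisym)
qed

definition krull_dim :: "('a, 'm) ring_scheme \<Rightarrow> enat" where
  "krull_dim R = Sup {enat n | n. \<exists>P :: nat \<Rightarrow> 'a set.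
     (\<forall>i\<le>n. P i \<in> spectrum R) \<and> (\<forall>i<n. P i \<subset> P (Suc i))}"


section \<open>Sheaves of abelian groups\<close>

text \<open>
  Abelian groups are the (multiplicatively written) \<open>comm_group\<close>s of \<open>HOL-Algebra\<close>.
  \<open>res F U W\<close> is the restriction map from the sections over \<open>U\<close> to those over \<open>W\<close>, for opens
  \<open>W \<subseteq> U\<close>; values of a presheaf on sets that are not open are irrelevant.
\<close>

record ('x, 'b) psh =
  sect :: "'x set \<Rightarrow> 'b monoid"
  res :: "'x set \<Rightarrow> 'x set \<Rightarrow> 'b \<Rightarrow> 'b"

definition presheaf :: "'x topology \<Rightarrow> ('x, 'b) psh \<Rightarrow> bool" where
  "presheaf X F \<longleftrightarrow>
     (\<forall>U. openin X U \<longrightarrow> comm_group (sect F U)) \<and>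
     (\<forall>U W. openin X U \<and> openin X W \<and> W \<subseteq> U \<longrightarrow> res F U W \<in> hom (sect F U) (sect F W)) \<and>
     (\<forall>U. openin X U \<longrightarrow> (\<forall>s\<in>carrier (sect F U). res F U U s = s)) \<and>
     (\<forall>U W W'. openin X U \<and> openin X W \<and> openin X W' \<and> W' \<subseteq> W \<and> W \<subseteq> U \<longrightarrow>
        (\<forall>s\<in>carrier (sect F U). res F W W' (res F U W s) = res F U W' s))"

text \<open>
  The family \<open>\<W>\<close> may be empty, which forces the sections over the empty set to be trivial.
\<close>

definition sheaf :: "'x topology \<Rightarrow> ('x, 'b) psh \<Rightarrow> bool" where
  "sheaf X F \<longleftrightarrow> presheaf X F \<and>
     (\<forall>\<W> s. (\<forall>W\<in>\<W>. openin X W \<and> s W \<in> carrier (sect F W)) \<and>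
             (\<forall>W\<in>\<W>. \<forall>W'\<in>\<W>. res F W (W \<inter> W') (s W) = res F W' (W \<inter> W') (s W')) \<longrightarrow>
             (\<exists>!t. t \<in> carrier (sect F (\<Union>\<W>)) \<and> (\<forall>W\<in>\<W>. res F (\<Union>\<W>) W t = s W)))"

text \<open>
  The restriction \<open>F|\<^sub>U\<close> to an open set \<open>U\<close>, a sheaf on \<open>subtopology X U\<close>. The opens
  of the latter are the opens \<open>W \<subseteq> U\<close> of \<open>X\<close>, for which \<open>U \<inter> W = W\<close>.
\<close>

definition restrict_psh :: "('x, 'b) psh \<Rightarrow> 'x set \<Rightarrow> ('x, 'b) psh" where
  "restrict_psh F U = \<lparr>sect = (\<lambda>W. sect F (U \<inter> W)), res = (\<lambda>W W'. res F (U \<inter> W) (U \<inter> W'))\<rparr>"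

definition psh_hom ::
    "'x topology \<Rightarrow> ('x, 'b) psh \<Rightarrow> ('x, 'c) psh \<Rightarrow> ('x set \<Rightarrow> 'b \<Rightarrow> 'c) set" where
  "psh_hom X F G = {\<phi>.
     (\<forall>U. openin X U \<longrightarrow> \<phi> U \<in> hom (sect F U) (sect G U)) \<and>
     (\<forall>U W. openin X U \<and> openin X W \<and> W \<subseteq> U \<longrightarrow>
        (\<forall>s\<in>carrier (sect F U). \<phi> W (res F U W s) = res G U W (\<phi> U s)))}"

definition psh_mono ::
    "'x topology \<Rightarrow> ('x, 'b) psh \<Rightarrow> ('x, 'c) psh \<Rightarrow> ('x set \<Rightarrow> 'b \<Rightarrow> 'c) set" where
  "psh_mono X F G =
     {\<phi> \<in> psh_hom X F G. \<forall>U. openin X U \<longrightarrow> inj_on (\<phi> U) (carrier (sect F U))}"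

text \<open>
  Exactness of \<open>F \<rightarrow> G \<rightarrow> H\<close> at \<open>G\<close> in the category of sheaves: a section of \<open>G\<close> is killed by \<open>\<psi>\<close>
  iff it lies in the image sheaf of \<open>\<phi>\<close>, that is, iff it comes from \<open>F\<close> locally.
\<close>

definition sheaf_exact_at ::
    "'x topology \<Rightarrow> ('x, 'b) psh \<Rightarrow> ('x set \<Rightarrow> 'b \<Rightarrow> 'c) \<Rightarrow> ('x, 'c) psh \<Rightarrow>
     ('x set \<Rightarrow> 'c \<Rightarrow> 'd) \<Rightarrow> ('x, 'd) psh \<Rightarrow> bool" where
  "sheaf_exact_at X F \<phi> G \<psi> H \<longleftrightarrow>
     (\<forall>U t. openin X U \<and> t \<in> carrier (sect G U) \<longrightarrow>
        (\<psi> U t = \<one>\<^bsub>sect H U\<^esub> \<longleftrightarrow>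
         (\<forall>x\<in>U. \<exists>W. openin X W \<and> x \<in> W \<and> W \<subseteq> U \<and> res G U W t \<in> \<phi> W ` carrier (sect F W))))"


section \<open>Injective resolutions\<close>

text \<open>
  HOL cannot quantify over the value types of all sheaves inside a formula, so injective objects
  are taken in the category of sheaves on a space with points in \<open>'x\<close> whose sections have
  values in one type \<open>('x, 'b) univ\<close>, chosen large enough for this to be the usual notion:
  \<^item> Every \<open>'b\<close>-valued sheaf is isomorphic to one in this category. The category contains the
    extensions by zero of the constant sheaves of integers on open subsets and all their subsheaves
    (these are small enough to be coded by functions from \<open>'x\<close> to the integers). As these extensions
    generate all sheaves, Baer's criterion shows that an injective object of this category has the
    extension property for sheaves with values in any type.
  \<^item> There are enough injectives. The cardinality of \<open>('x, 'b) univ\<close> is infinite, at least that of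
    \<open>'x set\<close>, and unchanged by taking functions from \<open>'x\<close> or from \<open>nat\<close> into it; hence stalks of
    sheaves in the category, their divisible hulls, and products of skyscraper sheaves on these again
    have values in \<open>('x, 'b) univ\<close>, up to isomorphism.
\<close>

type_synonym ('x, 'b) univ = "'x list \<Rightarrow> 'b + nat"

definition injective_sheaf :: "'x topology \<Rightarrow> ('x, ('x, 'b) univ) psh \<Rightarrow> bool" where
  "injective_sheaf X I \<longleftrightarrow> sheaf X I \<and>
     (\<forall>(A :: ('x, ('x, 'b) univ) psh) (B :: ('x, ('x, 'b) univ) psh).
        \<forall>\<iota>\<in>psh_mono X A B. \<forall>f\<in>psh_hom X A I.
          sheaf X A \<and> sheaf X B \<longrightarrow>
          (\<exists>g\<in>psh_hom X B I. \<forall>U. openin X U \<longrightarrow> (\<forall>a\<in>carrier (sect A U). g U (\<iota> U a) = f U a)))"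

text \<open>
  \<open>0 \<rightarrow> F \<rightarrow> I 0 \<rightarrow> I 1 \<rightarrow> \<dots>\<close> with augmentation \<open>\<epsilon>\<close> and differentials \<open>d\<close> is an injective resolution.
\<close>

definition injective_resolution ::
    "'x topology \<Rightarrow> ('x, 'b) psh \<Rightarrow>
     ('x set \<Rightarrow> 'b \<Rightarrow> ('x, 'b) univ) \<Rightarrow>
     (nat \<Rightarrow> ('x, ('x, 'b) univ) psh) \<Rightarrow>
     (nat \<Rightarrow> 'x set \<Rightarrow> ('x, 'b) univ \<Rightarrow> ('x, 'b) univ) \<Rightarrow> bool" where
  "injective_resolution X F \<epsilon> I d \<longleftrightarrow>
     (\<forall>n. injective_sheaf X (I n)) \<and>
     \<epsilon> \<in> psh_mono X F (I 0) \<and>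
     (\<forall>n. d n \<in> psh_hom X (I n) (I (Suc n))) \<and>
     sheaf_exact_at X F \<epsilon> (I 0) (d 0) (I 1) \<and>
     (\<forall>n. sheaf_exact_at X (I n) (d n) (I (Suc n)) (d (Suc n)) (I (Suc (Suc n))))"


section \<open>Derived functors\<close>

definition boundaries :: "(nat \<Rightarrow> 'c monoid) \<Rightarrow> (nat \<Rightarrow> 'c \<Rightarrow> 'c) \<Rightarrow> nat \<Rightarrow> 'c set" where
  "boundaries C d i = (case i of 0 \<Rightarrow> {\<one>\<^bsub>C 0\<^esub>} | Suc j \<Rightarrow> d j ` carrier (C j))"

definition cohomology :: "(nat \<Rightarrow> 'c monoid) \<Rightarrow> (nat \<Rightarrow> 'c \<Rightarrow> 'c) \<Rightarrow> nat \<Rightarrow> 'c set monoid" where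
  "cohomology C d i =
     (C i)\<lparr>carrier := kernel (C i) (C (Suc i)) (d i)\<rparr> Mod boundaries C d i"

definition supported_sections :: "'x topology \<Rightarrow> 'x set \<Rightarrow> ('x, 'b) psh \<Rightarrow> 'b monoid" where
  "supported_sections X Z F =
     (let S = topspace X; U = topspace X - Z
      in (sect F S)\<lparr>carrier := kernel (sect F S) (sect F U) (res F S U)\<rparr>)"

text \<open>
  The right derived functors of \<open>\<Gamma>\<^sub>Z\<close> and of the global sections, computed from an injective
  resolution \<open>(I, d)\<close> of a sheaf. They depend on the choice of resolution only up to isomorphism,
  so statements about them are made for every injective resolution of the sheaf.
\<close>

definition local_cohomology ::
    "'x topology \<Rightarrow> 'x set \<Rightarrow> (nat \<Rightarrow> ('x, 'b) psh) \<Rightarrow> (nat \<Rightarrow> 'x set \<Rightarrow> 'b \<Rightarrow> 'b) \<Rightarrow> nat \<Rightarrow> 'b set monoid"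
  where
  "local_cohomology X Z I d i =
     cohomology (\<lambda>n. supported_sections X Z (I n)) (\<lambda>n. d n (topspace X)) i"

definition sheaf_cohomology ::
    "'x topology \<Rightarrow> (nat \<Rightarrow> ('x, 'b) psh) \<Rightarrow> (nat \<Rightarrow> 'x set \<Rightarrow> 'b \<Rightarrow> 'b) \<Rightarrow> nat \<Rightarrow> 'b set monoid" where
  "sheaf_cohomology X I d i =
     cohomology (\<lambda>n. sect (I n) (topspace X)) (\<lambda>n. d n (topspace X)) i"

end

theory Submission
  imports Defs
begin

text \<open>
  The open subsets of \<open>Spec V\<close> form a chain. Extension by zero from an open set \<open>U\<close> is therefore
  already a sheaf, and it shows that injective sheaves restrict to injective sheaves on \<open>U\<close> and
  that their sections extend from \<open>U\<close> to \<open>X\<close>. As \<open>X\<close> is the only neighbourhood of the closed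
  point, \<open>\<Gamma>(X, -)\<close> is exact. Hence, for an injective resolution \<open>I\<close> of \<open>F\<close>, the long exact sequence
  of \<open>0 \<rightarrow> \<Gamma>\<^sub>Z(I) \<rightarrow> I(X) \<rightarrow> I(U) \<rightarrow> 0\<close> identifies \<open>H\<^sup>i\<Gamma>\<^sub>Z(F)\<close> with the cohomology of \<open>I(U)\<close> in degree
  \<open>i - 1\<close> for \<open>i > 1\<close>, and with the cokernel of the restriction map for \<open>i = 1\<close>. If \<open>U\<close> is
  quasi-compact, for instance because \<open>X\<close> is finite, then \<open>U\<close> is not the union of the smaller open
  sets, so it too is empty or the only neighbourhood in \<open>U\<close> of some point, and \<open>\<Gamma>(U, -)\<close> is exact.
\<close>

section \<open>Quotients of abelian groups and cohomology of complexes\<close>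

text \<open>Injectivity is tested only on monomorphisms between sheaves with values in
  \<open>univ\<close>, whereas \<open>F\<close> has values in another type and a differential is not
  a monomorphism. Every extension is therefore made through an image sheaf, a subsheaf of a
  \<open>univ\<close>-valued sheaf, to which a morphism descends as soon as it kills the kernel
  (\<open>injective_sheaf_extend\<close>). The resolution of the restriction of \<open>F\<close> to
  \<open>U\<close> in the claim is arbitrary, while the long exact sequence yields the cohomology of
  the restricted resolution. The gap is closed by the comparison theorem for injective resolutions,
  proved here from such extensions. The long exact sequence takes the form of a zigzag of quotients.
  In it the kernel of \<open>d n\<close> is described by a sheaf \<open>A\<close> that maps onto it:
  \<open>A\<close> is \<open>F\<close> in degree 1 and the preceding term of the resolution in
  higher degrees, so both halves of (1) are instances of one isomorphism.\<close>

lemma trivial_group_Mod_carrier: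
  assumes "group G" "N = carrier G"
  shows "trivial_group (G Mod N)"
proof -
  interpret group G by fact
  have N: "N \<lhd> G" using assms(2) normal_self by simp
  have "carrier (G Mod N) = {N}"
    using assms(2) one_closed by (auto simp: FactGroup_def RCOSETS_def coset_join2 subgroup_self)
  then show ?thesis
    using group.trivial_group[OF normal.factorgroup_is_group[OF N]] by blast
qed

text \<open>By the first isomorphism theorem both quotients are \<open>K\<close> modulo the same
  subgroup. Surjectivity of \<open>p\<close> and \<open>q\<close> is asked for only modulo
  \<open>N\<close> and \<open>M\<close>, which is what homotopies provide.\<close>

lemma Mod_iso_zigzag:
  assumes G: "comm_group G" and H: "comm_group H" and K: "group K"
    and N: "subgroup N G" and M: "subgroup M H"
    and p: "p \<in> hom K G" and q: "q \<in> hom K H"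
    and p_onto: "\<And>g. g \<in> carrier G \<Longrightarrow> \<exists>k\<in>carrier K. \<exists>n\<in>N. p k = n \<otimes>\<^bsub>G\<^esub> g"
    and q_onto: "\<And>h. h \<in> carrier H \<Longrightarrow> \<exists>k\<in>carrier K. \<exists>n\<in>M. q k = n \<otimes>\<^bsub>H\<^esub> h"
    and iff: "\<And>k. k \<in> carrier K \<Longrightarrow> p k \<in> N \<longleftrightarrow> q k \<in> M"
  shows "G Mod N \<cong> H Mod M"
proof -
  \<comment> \<open>Stated for a fresh group of arbitrary type, so that it serves once for
    \<open>p\<close> and once for \<open>q\<close>.\<close>
  have quot: "K Mod {k \<in> carrier K. p k \<in> N} \<cong> G Mod N \<and> group (K Mod {k \<in> carrier K. p k \<in> N})"
    if G: "comm_group G" and N: "subgroup N G" and p: "p \<in> hom K G"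
      and onto: "\<And>g. g \<in> carrier G \<Longrightarrow> \<exists>k\<in>carrier K. \<exists>n\<in>N. p k = n \<otimes>\<^bsub>G\<^esub> g"
    for G :: "('z, 'y) monoid_scheme" and N p
  proof -
    interpret G: comm_group G by fact
    interpret N: normal N G using N by (rule G.subgroup_imp_normal)
    have pc: "p k \<in> carrier G" if "k \<in> carrier K" for k
      using p that by (rule hom_in_carrier)
    have h: "(\<lambda>k. N #>\<^bsub>G\<^esub> p k) \<in> hom K (G Mod N)"
      using hom_compose[OF p N.r_coset_hom_Mod] by (simp add: comp_def)
    interpret h: group_hom K "G Mod N" "\<lambda>k. N #>\<^bsub>G\<^esub> p k"
      using K N.factorgroup_is_group h by (simp add: group_hom_def group_hom_axioms_def)
    have "N #>\<^bsub>G\<^esub> p k = N \<longleftrightarrow> p k \<in> N" if "k \<in> carrier K" for k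
      using pc[OF that] N G.coset_join1 G.coset_join2 N.subset by blast
    then have ker: "kernel K (G Mod N) (\<lambda>k. N #>\<^bsub>G\<^esub> p k) = {k \<in> carrier K. p k \<in> N}"
      by (auto simp: kernel_def FactGroup_def)
    have "N #>\<^bsub>G\<^esub> g \<in> (\<lambda>k. N #>\<^bsub>G\<^esub> p k) ` carrier K" if g: "g \<in> carrier G" for g
    proof -
      from onto[OF g] obtain k n where k: "k \<in> carrier K" "n \<in> N" "p k = n \<otimes>\<^bsub>G\<^esub> g" by blast
      then have "p k \<in> N #>\<^bsub>G\<^esub> g" by (auto simp: r_coset_def)
      then have "N #>\<^bsub>G\<^esub> g = N #>\<^bsub>G\<^esub> p k"
        using G.repr_independence N g by blast
      then show ?thesis using k(1) by blast
    qed
    then have "(\<lambda>k. N #>\<^bsub>G\<^esub> p k) ` carrier K = carrier (G Mod N)"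
      using h.hom_closed by (auto simp: FactGroup_def RCOSETS_def)
    from h.FactGroup_iso[OF this] normal.factorgroup_is_group[OF h.normal_kernel] ker
    show ?thesis by simp
  qed
  have "{k \<in> carrier K. p k \<in> N} = {k \<in> carrier K. q k \<in> M}" using iff by blast
  then show ?thesis
    using quot[OF G N p p_onto] quot[OF H M q q_onto] group.iso_sym iso_trans by metis
qed

lemma comm_group_carrier_update:
  assumes "comm_group G" "subgroup A G"
  shows "comm_group (G\<lparr>carrier := A\<rparr>)"
proof -
  interpret comm_group G by fact
  interpret A: subgroup A G by fact
  show ?thesis
    by (rule group.group_comm_groupI[OF A.subgroup_is_group]) (auto intro: m_comm)
qed

lemma group_homI: "\<lbrakk>comm_group G; comm_group H; h \<in> hom G H\<rbrakk> \<Longrightarrow> group_hom G H h"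
  by (simp add: comm_group_def group_hom_def group_hom_axioms_def)

lemma comm_group_kernel:
  "\<lbrakk>comm_group G; comm_group H; h \<in> hom G H\<rbrakk> \<Longrightarrow> comm_group (G\<lparr>carrier := kernel G H h\<rparr>)"
  by (intro comm_group_carrier_update group_hom.subgroup_kernel group_homI)

lemma subgroup_boundaries:
  assumes C: "\<And>n. comm_group (C n)"
    and d: "\<And>n. d n \<in> hom (C n) (C (Suc n))"
    and dd: "\<And>n x. x \<in> carrier (C n) \<Longrightarrow> d (Suc n) (d n x) = \<one>\<^bsub>C (Suc (Suc n))\<^esub>"
  shows "subgroup (boundaries C d i) ((C i)\<lparr>carrier := kernel (C i) (C (Suc i)) (d i)\<rparr>)"
proof -
  interpret C: group "C i" using C comm_group_def by blast
  interpret d: group_hom "C i" "C (Suc i)" "d i" by (intro group_homI C d)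
  have "subgroup (boundaries C d i) (C i)"
  proof (cases i)
    case 0
    then show ?thesis using C.triv_subgroup by (simp add: boundaries_def)
  next
    case (Suc j)
    then show ?thesis
      using group_hom.img_is_subgroup[OF group_homI[OF C C d[of j]]] by (simp add: boundaries_def)
  qed
  moreover have "boundaries C d i \<subseteq> kernel (C i) (C (Suc i)) (d i)"
  proof (cases i)
    case 0
    then show ?thesis using d.hom_one C.one_closed by (auto simp: boundaries_def kernel_def)
  next
    case (Suc j)
    then show ?thesis using dd hom_in_carrier[OF d] by (auto simp: boundaries_def kernel_def)
  qed
  ultimately show ?thesis
    using C.subgroup_incl d.subgroup_kernel by blast
qed

section \<open>Sheaves\<close>

lemma sheaf_imp_presheaf: "sheaf X F \<Longrightarrow> presheaf X F"
  by (simp add: sheaf_def)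

lemma injective_imp_sheaf: "injective_sheaf X I \<Longrightarrow> sheaf X I"
  by (simp add: injective_sheaf_def)

lemma
  assumes "presheaf X F" "openin X U"
  shows presheaf_comm_group: "comm_group (sect F U)"
    and presheaf_group: "group (sect F U)"
    and presheaf_res_self: "s \<in> carrier (sect F U) \<Longrightarrow> res F U U s = s"
  using assms by (auto simp: presheaf_def comm_group_def)

lemma
  assumes "presheaf X F" "openin X U" "openin X W" "W \<subseteq> U"
  shows presheaf_res_hom: "res F U W \<in> hom (sect F U) (sect F W)"
    and presheaf_res_closed: "s \<in> carrier (sect F U) \<Longrightarrow> res F U W s \<in> carrier (sect F W)"
    and presheaf_res_mult: "\<lbrakk>s \<in> carrier (sect F U); t \<in> carrier (sect F U)\<rbrakk>
      \<Longrightarrow> res F U W (s \<otimes>\<^bsub>sect F U\<^esub> t) = res F U W s \<otimes>\<^bsub>sect F W\<^esub> res F U W t"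
    and presheaf_res_one: "res F U W \<one>\<^bsub>sect F U\<^esub> = \<one>\<^bsub>sect F W\<^esub>"
    and presheaf_res_inv: "s \<in> carrier (sect F U)
      \<Longrightarrow> res F U W (inv\<^bsub>sect F U\<^esub> s) = inv\<^bsub>sect F W\<^esub> res F U W s"
proof -
  show h: "res F U W \<in> hom (sect F U) (sect F W)"
    using assms by (simp add: presheaf_def)
  interpret group_hom "sect F U" "sect F W" "res F U W"
    using h assms by (intro group_homI presheaf_comm_group)
  show "s \<in> carrier (sect F U) \<Longrightarrow> res F U W s \<in> carrier (sect F W)"
    "\<lbrakk>s \<in> carrier (sect F U); t \<in> carrier (sect F U)\<rbrakk>
      \<Longrightarrow> res F U W (s \<otimes>\<^bsub>sect F U\<^esub> t) = res F U W s \<otimes>\<^bsub>sect F W\<^esub> res F U W t"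
    "res F U W \<one>\<^bsub>sect F U\<^esub> = \<one>\<^bsub>sect F W\<^esub>"
    "s \<in> carrier (sect F U) \<Longrightarrow> res F U W (inv\<^bsub>sect F U\<^esub> s) = inv\<^bsub>sect F W\<^esub> res F U W s"
    by simp_all
qed

lemma presheaf_res_res:
  "\<lbrakk>presheaf X F; openin X U; openin X W; openin X W'; W' \<subseteq> W; W \<subseteq> U; s \<in> carrier (sect F U)\<rbrakk>
    \<Longrightarrow> res F W W' (res F U W s) = res F U W' s"
  by (simp add: presheaf_def)

lemma psh_homI:
  assumes "\<And>U. openin X U \<Longrightarrow> \<phi> U \<in> hom (sect F U) (sect G U)"
    and "\<And>U W s. \<lbrakk>openin X U; openin X W; W \<subseteq> U; s \<in> carrier (sect F U)\<rbrakk>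
      \<Longrightarrow> \<phi> W (res F U W s) = res G U W (\<phi> U s)"
  shows "\<phi> \<in> psh_hom X F G"
  using assms by (simp add: psh_hom_def)

lemma
  assumes "\<phi> \<in> psh_hom X F G" "openin X U"
  shows psh_hom_hom: "\<phi> U \<in> hom (sect F U) (sect G U)"
    and psh_hom_closed: "s \<in> carrier (sect F U) \<Longrightarrow> \<phi> U s \<in> carrier (sect G U)"
    and psh_hom_mult: "\<lbrakk>s \<in> carrier (sect F U); t \<in> carrier (sect F U)\<rbrakk>
      \<Longrightarrow> \<phi> U (s \<otimes>\<^bsub>sect F U\<^esub> t) = \<phi> U s \<otimes>\<^bsub>sect G U\<^esub> \<phi> U t"
proof -
  show h: "\<phi> U \<in> hom (sect F U) (sect G U)"
    using assms by (simp add: psh_hom_def)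
  show "s \<in> carrier (sect F U) \<Longrightarrow> \<phi> U s \<in> carrier (sect G U)"
    "\<lbrakk>s \<in> carrier (sect F U); t \<in> carrier (sect F U)\<rbrakk>
      \<Longrightarrow> \<phi> U (s \<otimes>\<^bsub>sect F U\<^esub> t) = \<phi> U s \<otimes>\<^bsub>sect G U\<^esub> \<phi> U t"
    using h by (auto simp: hom_def)
qed

lemma psh_hom_res:
  "\<lbrakk>\<phi> \<in> psh_hom X F G; openin X U; openin X W; W \<subseteq> U; s \<in> carrier (sect F U)\<rbrakk>
    \<Longrightarrow> \<phi> W (res F U W s) = res G U W (\<phi> U s)"
  by (simp add: psh_hom_def)

lemma
  assumes "\<phi> \<in> psh_hom X F G" "presheaf X F" "presheaf X G" "openin X U"
  shows psh_hom_one: "\<phi> U \<one>\<^bsub>sect F U\<^esub> = \<one>\<^bsub>sect G U\<^esub>"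
    and psh_hom_inv: "s \<in> carrier (sect F U)
      \<Longrightarrow> \<phi> U (inv\<^bsub>sect F U\<^esub> s) = inv\<^bsub>sect G U\<^esub> \<phi> U s"
proof -
  have g: "group_hom (sect F U) (sect G U) (\<phi> U)"
    using assms by (intro group_homI presheaf_comm_group psh_hom_hom)
  show "\<phi> U \<one>\<^bsub>sect F U\<^esub> = \<one>\<^bsub>sect G U\<^esub>"
    "s \<in> carrier (sect F U) \<Longrightarrow> \<phi> U (inv\<^bsub>sect F U\<^esub> s) = inv\<^bsub>sect G U\<^esub> \<phi> U s"
    using group_hom.hom_one[OF g] group_hom.hom_inv[OF g] by auto
qed

lemma psh_hom_comp:
  assumes "\<phi> \<in> psh_hom X F G" "\<psi> \<in> psh_hom X G H"
  shows "(\<lambda>U s. \<psi> U (\<phi> U s)) \<in> psh_hom X F H"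
proof (rule psh_homI)
  show "(\<lambda>s. \<psi> U (\<phi> U s)) \<in> hom (sect F U) (sect H U)" if "openin X U" for U
    using hom_compose[OF psh_hom_hom[OF assms(1) that] psh_hom_hom[OF assms(2) that]]
    by (simp add: comp_def)
qed (simp add: psh_hom_res[OF assms(1)] psh_hom_res[OF assms(2)] psh_hom_closed[OF assms(1)])

lemma psh_hom_div:
  assumes "\<phi> \<in> psh_hom X F G" "\<psi> \<in> psh_hom X F G" "presheaf X G"
  shows "(\<lambda>U s. \<phi> U s \<otimes>\<^bsub>sect G U\<^esub> inv\<^bsub>sect G U\<^esub> \<psi> U s) \<in> psh_hom X F G"
proof (rule psh_homI)
  fix U assume U: "openin X U"
  interpret comm_group "sect G U" using assms(3) U by (rule presheaf_comm_group)
  show "(\<lambda>s. \<phi> U s \<otimes>\<^bsub>sect G U\<^esub> inv\<^bsub>sect G U\<^esub> \<psi> U s) \<in> hom (sect F U) (sect G U)"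
    using psh_hom_closed[OF assms(1) U] psh_hom_closed[OF assms(2) U]
    by (auto simp: hom_def psh_hom_mult[OF assms(1) U] psh_hom_mult[OF assms(2) U] inv_mult m_ac)
next
  fix U W s assume A: "openin X U" "openin X W" "W \<subseteq> U" and s: "s \<in> carrier (sect F U)"
  interpret comm_group "sect G U" using assms(3) A(1) by (rule presheaf_comm_group)
  show "\<phi> W (res F U W s) \<otimes>\<^bsub>sect G W\<^esub> inv\<^bsub>sect G W\<^esub> \<psi> W (res F U W s) =
      res G U W (\<phi> U s \<otimes>\<^bsub>sect G U\<^esub> inv\<^bsub>sect G U\<^esub> \<psi> U s)"
    using psh_hom_closed[OF assms(1) A(1) s] psh_hom_closed[OF assms(2) A(1) s]
    by (simp add: psh_hom_res[OF assms(1) A s] psh_hom_res[OF assms(2) A s]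
        presheaf_res_mult[OF assms(3) A] presheaf_res_inv[OF assms(3) A])
qed

lemma sheaf_unique_glue:
  assumes "sheaf X F"
    and "\<And>W. W \<in> \<W> \<Longrightarrow> openin X W \<and> s W \<in> carrier (sect F W)"
    and "\<And>W W'. \<lbrakk>W \<in> \<W>; W' \<in> \<W>\<rbrakk> \<Longrightarrow> res F W (W \<inter> W') (s W) = res F W' (W \<inter> W') (s W')"
  shows "\<exists>!t. t \<in> carrier (sect F (\<Union>\<W>)) \<and> (\<forall>W\<in>\<W>. res F (\<Union>\<W>) W t = s W)"
proof -
  have "(\<forall>W\<in>\<W>. openin X W \<and> s W \<in> carrier (sect F W)) \<and>
      (\<forall>W\<in>\<W>. \<forall>W'\<in>\<W>. res F W (W \<inter> W') (s W) = res F W' (W \<inter> W') (s W'))"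
    by (intro conjI ballI assms(3)) (simp_all add: assms(2))
  then show ?thesis
    by (rule assms(1)[unfolded sheaf_def, THEN conjunct2, rule_format])
qed

text \<open>Both sections glue the same family, indexed by all open sets on which they agree, so the
  uniqueness half of the sheaf condition applies.\<close>

lemma sheaf_local_eq:
  assumes F: "sheaf X F" and U: "openin X U"
    and s: "s \<in> carrier (sect F U)" and t: "t \<in> carrier (sect F U)"
    and loc: "\<And>x. x \<in> U \<Longrightarrow> \<exists>W. openin X W \<and> x \<in> W \<and> W \<subseteq> U \<and> res F U W s = res F U W t"
  shows "s = t"
proof -
  let ?W = "{W. openin X W \<and> W \<subseteq> U \<and> res F U W s = res F U W t}"
  have P: "presheaf X F" using F by (rule sheaf_imp_presheaf)
  have UW: "\<Union>?W = U" using loc by blast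
  have "\<exists>!c. c \<in> carrier (sect F (\<Union>?W)) \<and> (\<forall>W\<in>?W. res F (\<Union>?W) W c = res F U W s)"
  proof (rule sheaf_unique_glue[OF F])
    show "openin X W \<and> res F U W s \<in> carrier (sect F W)" if "W \<in> ?W" for W
      using that presheaf_res_closed[OF P U _ _ s] by blast
    show "res F W (W \<inter> W') (res F U W s) = res F W' (W \<inter> W') (res F U W' s)"
      if "W \<in> ?W" "W' \<in> ?W" for W W'
    proof -
      have W: "openin X W" "W \<subseteq> U" "openin X W'" "W' \<subseteq> U" "openin X (W \<inter> W')"
        using that by (auto intro: openin_Int)
      show ?thesis
        using presheaf_res_res[OF P U W(1,5) _ W(2) s] presheaf_res_res[OF P U W(3,5) _ W(4) s] by simp
    qed
  qed
  then have "\<exists>!c. c \<in> carrier (sect F U) \<and> (\<forall>W\<in>?W. res F U W c = res F U W s)"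
    using UW by simp
  moreover have "\<forall>W\<in>?W. res F U W t = res F U W s" by simp
  ultimately show ?thesis using s t by blast
qed

text \<open>Over the empty set, agreement near every point is a vacuous condition.\<close>

lemma sheaf_empty:
  assumes "sheaf X F" "t \<in> carrier (sect F {})"
  shows "t = \<one>\<^bsub>sect F {}\<^esub>"
proof -
  interpret group "sect F {}" using sheaf_imp_presheaf[OF assms(1)] by (rule presheaf_group) simp
  show ?thesis using sheaf_local_eq[OF assms(1) openin_empty assms(2) one_closed] by simp
qed

section \<open>Image sheaves\<close>

definition image_sections ::
    "'x topology \<Rightarrow> ('x, 'b) psh \<Rightarrow> ('x set \<Rightarrow> 'b \<Rightarrow> 'c) \<Rightarrow> ('x, 'c) psh \<Rightarrow> 'x set \<Rightarrow> 'c set" where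
  "image_sections X A \<phi> B U = {t \<in> carrier (sect B U).
     \<forall>x\<in>U. \<exists>W. openin X W \<and> x \<in> W \<and> W \<subseteq> U \<and> res B U W t \<in> \<phi> W ` carrier (sect A W)}"

lemma image_sectionsE:
  assumes "t \<in> image_sections X A \<phi> B U" "x \<in> U"
  obtains W a where "openin X W" "x \<in> W" "W \<subseteq> U" "a \<in> carrier (sect A W)" "res B U W t = \<phi> W a"
  using assms unfolding image_sections_def by blast

text \<open>The group law and the restrictions are those of \<open>B\<close>. Hence the image has
  the value type of \<open>B\<close>, in particular \<open>univ\<close> when \<open>B\<close> is a
  term of a resolution, whatever the value type of \<open>A\<close>.\<close>

definition image_psh ::
    "'x topology \<Rightarrow> ('x, 'b) psh \<Rightarrow> ('x set \<Rightarrow> 'b \<Rightarrow> 'c) \<Rightarrow> ('x, 'c) psh \<Rightarrow> ('x, 'c) psh" where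
  "image_psh X A \<phi> B =
     \<lparr>sect = (\<lambda>U. (sect B U)\<lparr>carrier := image_sections X A \<phi> B U\<rparr>), res = res B\<rparr>"

lemma sheaf_exact_at_iff:
  "sheaf_exact_at X A \<phi> B \<psi> C \<longleftrightarrow> (\<forall>U t. openin X U \<and> t \<in> carrier (sect B U) \<longrightarrow>
     (\<psi> U t = \<one>\<^bsub>sect C U\<^esub> \<longleftrightarrow> t \<in> image_sections X A \<phi> B U))"
  by (auto simp: sheaf_exact_at_def image_sections_def)

context
  fixes X :: "'x topology" and A :: "('x, 'b) psh" and B :: "('x, 'c) psh" and \<phi>
  assumes A: "presheaf X A" and B: "presheaf X B" and \<phi>: "\<phi> \<in> psh_hom X A B"
begin

lemma image_sections_res:
  assumes UW: "openin X U" "openin X W" "W \<subseteq> U" and t: "t \<in> image_sections X A \<phi> B U"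
  shows "res B U W t \<in> image_sections X A \<phi> B W"
proof -
  have tB: "t \<in> carrier (sect B U)" using t by (simp add: image_sections_def)
  have "\<exists>W'. openin X W' \<and> x \<in> W' \<and> W' \<subseteq> W \<and> res B W W' (res B U W t) \<in> \<phi> W' ` carrier (sect A W')"
    if "x \<in> W" for x
  proof -
    obtain V a where V: "openin X V" "x \<in> V" "V \<subseteq> U" and a: "a \<in> carrier (sect A V)"
      "res B U V t = \<phi> V a"
      using image_sectionsE[OF t] \<open>x \<in> W\<close> UW(3) by blast
    have VW: "openin X (V \<inter> W)" "V \<inter> W \<subseteq> V" using V UW by (auto intro: openin_Int)
    have "res B W (V \<inter> W) (res B U W t) = res B V (V \<inter> W) (res B U V t)"
      using presheaf_res_res[OF B UW(1) _ _ _ _ tB] VW V UW by simp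
    also have "\<dots> = \<phi> (V \<inter> W) (res A V (V \<inter> W) a)"
      using psh_hom_res[OF \<phi> V(1) VW a(1)] a(2) by simp
    finally show ?thesis
      using VW V that presheaf_res_closed[OF A V(1) VW a(1)] by (intro exI[of _ "V \<inter> W"]) auto
  qed
  then show ?thesis using presheaf_res_closed[OF B UW tB] by (simp add: image_sections_def)
qed

lemma image_sections_image:
  assumes "openin X U" "a \<in> carrier (sect A U)"
  shows "\<phi> U a \<in> image_sections X A \<phi> B U"
proof -
  have "\<phi> U a \<in> carrier (sect B U)" using psh_hom_closed[OF \<phi>] assms by blast
  then show ?thesis
    using assms presheaf_res_self[OF B] unfolding image_sections_def by force
qed

lemma subgroup_image_sections:
  assumes U: "openin X U"
  shows "subgroup (image_sections X A \<phi> B U) (sect B U)"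
proof -
  interpret B: comm_group "sect B U" using B U by (rule presheaf_comm_group)
  \<comment> \<open>Closure under division is checked on a common neighbourhood; inverses and
    products follow from it.\<close>
  have div: "s \<otimes>\<^bsub>sect B U\<^esub> inv\<^bsub>sect B U\<^esub> t \<in> image_sections X A \<phi> B U"
    if s: "s \<in> image_sections X A \<phi> B U" and t: "t \<in> image_sections X A \<phi> B U" for s t
  proof -
    have st: "s \<in> carrier (sect B U)" "t \<in> carrier (sect B U)"
      using s t by (auto simp: image_sections_def)
    have "\<exists>W. openin X W \<and> x \<in> W \<and> W \<subseteq> U \<and>
        res B U W (s \<otimes>\<^bsub>sect B U\<^esub> inv\<^bsub>sect B U\<^esub> t) \<in> \<phi> W ` carrier (sect A W)" if x: "x \<in> U" for x
    proof -
      obtain V a where V: "openin X V" "x \<in> V" "V \<subseteq> U" and a: "a \<in> carrier (sect A V)"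
        "res B U V s = \<phi> V a"
        using image_sectionsE[OF s x] .
      obtain W b where W: "openin X W" "x \<in> W" "W \<subseteq> U" and b: "b \<in> carrier (sect A W)"
        "res B U W t = \<phi> W b"
        using image_sectionsE[OF t x] .
      have VW: "openin X (V \<inter> W)" "V \<inter> W \<subseteq> V" "V \<inter> W \<subseteq> W" "V \<inter> W \<subseteq> U"
        using V W by (auto intro: openin_Int)
      interpret A: group "sect A (V \<inter> W)" using A VW(1) by (rule presheaf_group)
      let ?a = "res A V (V \<inter> W) a" and ?b = "res A W (V \<inter> W) b"
      have ab: "?a \<in> carrier (sect A (V \<inter> W))" "?b \<in> carrier (sect A (V \<inter> W))"
        using presheaf_res_closed[OF A] a b V W VW by auto
      have "res B U (V \<inter> W) s = \<phi> (V \<inter> W) ?a" "res B U (V \<inter> W) t = \<phi> (V \<inter> W) ?b"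
        using psh_hom_res[OF \<phi> V(1) VW(1,2) a(1)] psh_hom_res[OF \<phi> W(1) VW(1,3) b(1)]
          presheaf_res_res[OF B U V(1) VW(1,2) V(3) st(1)]
          presheaf_res_res[OF B U W(1) VW(1,3) W(3) st(2)] a(2) b(2) by auto
      then have "res B U (V \<inter> W) (s \<otimes>\<^bsub>sect B U\<^esub> inv\<^bsub>sect B U\<^esub> t) =
          \<phi> (V \<inter> W) (?a \<otimes>\<^bsub>sect A (V \<inter> W)\<^esub> inv\<^bsub>sect A (V \<inter> W)\<^esub> ?b)"
        using ab st presheaf_res_mult[OF B U VW(1,4)] presheaf_res_inv[OF B U VW(1,4)]
          psh_hom_mult[OF \<phi> VW(1)] psh_hom_inv[OF \<phi> A B VW(1)] by simp
      then show ?thesis using V W VW ab by (intro exI[of _ "V \<inter> W"]) auto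
    qed
    then show ?thesis using st by (simp add: image_sections_def)
  qed
  have one: "\<one>\<^bsub>sect B U\<^esub> \<in> image_sections X A \<phi> B U"
    using image_sections_image[OF U group.is_monoid[OF presheaf_group[OF A U], THEN monoid.one_closed]]
    by (simp add: psh_hom_one[OF \<phi> A B U])
  show ?thesis
  proof (rule B.subgroupI)
    show sub: "image_sections X A \<phi> B U \<subseteq> carrier (sect B U)"
      by (auto simp: image_sections_def)
    show inv: "inv\<^bsub>sect B U\<^esub> t \<in> image_sections X A \<phi> B U" if "t \<in> image_sections X A \<phi> B U" for t
      using div[OF one that] that sub by auto
    show "s \<otimes>\<^bsub>sect B U\<^esub> t \<in> image_sections X A \<phi> B U"
      if "s \<in> image_sections X A \<phi> B U" "t \<in> image_sections X A \<phi> B U" for s t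
      using div[OF that(1) inv[OF that(2)]] that sub by auto
  qed (use one in auto)
qed

lemma presheaf_image_psh: "presheaf X (image_psh X A \<phi> B)"
  unfolding presheaf_def
proof (intro conjI allI impI ballI)
  have sub: "t \<in> carrier (sect B U)" if "t \<in> image_sections X A \<phi> B U" for t U
    using that by (simp add: image_sections_def)
  let ?I = "image_psh X A \<phi> B"
  show "comm_group (sect ?I U)" if "openin X U" for U
    using comm_group_carrier_update[OF presheaf_comm_group[OF B that] subgroup_image_sections[OF that]]
    by (simp add: image_psh_def)
  show "res ?I U W \<in> hom (sect ?I U) (sect ?I W)" if "openin X U \<and> openin X W \<and> W \<subseteq> U" for U W
    using that image_sections_res presheaf_res_mult[OF B] sub by (simp add: image_psh_def hom_def)
  show "res ?I U U s = s" if "openin X U" "s \<in> carrier (sect ?I U)" for U s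
    using that presheaf_res_self[OF B] sub by (simp add: image_psh_def)
  show "res ?I W W' (res ?I U W s) = res ?I U W' s"
    if "openin X U \<and> openin X W \<and> openin X W' \<and> W' \<subseteq> W \<and> W \<subseteq> U" "s \<in> carrier (sect ?I U)" for U W W' s
    using that presheaf_res_res[OF B] sub by (simp add: image_psh_def)
qed

text \<open>Membership in \<open>image_sections\<close> is a local condition, so a section glued in
  \<open>B\<close> stays in the image.\<close>

lemma sheaf_image_psh:
  assumes "sheaf X B"
  shows "sheaf X (image_psh X A \<phi> B)"
  unfolding sheaf_def
proof (intro conjI allI impI presheaf_image_psh)
  fix \<W> :: "'x set set" and s :: "'x set \<Rightarrow> 'c"
  let ?I = "image_psh X A \<phi> B" and ?U = "\<Union>\<W>"
  assume "(\<forall>W\<in>\<W>. openin X W \<and> s W \<in> carrier (sect ?I W)) \<and>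
    (\<forall>W\<in>\<W>. \<forall>W'\<in>\<W>. res ?I W (W \<inter> W') (s W) = res ?I W' (W \<inter> W') (s W'))"
  then have s: "\<And>W. W \<in> \<W> \<Longrightarrow> openin X W \<and> s W \<in> image_sections X A \<phi> B W"
    and c: "\<And>W W'. \<lbrakk>W \<in> \<W>; W' \<in> \<W>\<rbrakk> \<Longrightarrow> res B W (W \<inter> W') (s W) = res B W' (W \<inter> W') (s W')"
    by (auto simp: image_psh_def)
  have U: "openin X ?U" using s by blast
  have "\<exists>!t. t \<in> carrier (sect B ?U) \<and> (\<forall>W\<in>\<W>. res B ?U W t = s W)"
    using s c by (intro sheaf_unique_glue[OF assms]) (auto simp: image_sections_def)
  then obtain t where t: "t \<in> carrier (sect B ?U)" "\<And>W. W \<in> \<W> \<Longrightarrow> res B ?U W t = s W"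
    and uniq: "\<And>t'. \<lbrakk>t' \<in> carrier (sect B ?U); \<forall>W\<in>\<W>. res B ?U W t' = s W\<rbrakk> \<Longrightarrow> t' = t"
    by blast
  have "\<exists>V. openin X V \<and> x \<in> V \<and> V \<subseteq> ?U \<and> res B ?U V t \<in> \<phi> V ` carrier (sect A V)"
    if x: "x \<in> ?U" for x
  proof -
    obtain W where W: "W \<in> \<W>" "x \<in> W" using x by blast
    obtain V a where V: "openin X V" "x \<in> V" "V \<subseteq> W" "a \<in> carrier (sect A V)" "res B W V (s W) = \<phi> V a"
      using image_sectionsE[OF s[OF W(1), THEN conjunct2] W(2)] .
    have "res B W V (s W) = res B ?U V t"
      using presheaf_res_res[OF B U _ V(1,3) _ t(1)] s[OF W(1)] W(1) t(2)[OF W(1)] by auto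
    then have "res B ?U V t \<in> \<phi> V ` carrier (sect A V)" using V(4,5) by (metis image_eqI)
    moreover have "V \<subseteq> ?U" using V(3) W(1) by blast
    ultimately show ?thesis using V(1,2) by blast
  qed
  then have im: "t \<in> image_sections X A \<phi> B ?U" using t(1) unfolding image_sections_def by blast
  show "\<exists>!t. t \<in> carrier (sect ?I ?U) \<and> (\<forall>W\<in>\<W>. res ?I ?U W t = s W)"
  proof (rule ex1I, intro conjI ballI)
    show "t' = t" if "t' \<in> carrier (sect ?I ?U) \<and> (\<forall>W\<in>\<W>. res ?I ?U W t' = s W)" for t'
      using that by (intro uniq) (simp_all add: image_psh_def image_sections_def)
  qed (use t(2) im in \<open>simp_all add: image_psh_def\<close>)
qed

lemma image_psh_inclusion: "(\<lambda>U s. s) \<in> psh_mono X (image_psh X A \<phi> B) B"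
  by (auto simp: psh_mono_def psh_hom_def image_psh_def hom_def image_sections_def)

section \<open>Descent of morphisms to the image sheaf\<close>

context
  fixes C :: "('x, 'd) psh" and \<psi>
  assumes C: "sheaf X C" and \<psi>: "\<psi> \<in> psh_hom X A C"
    and ker: "\<And>U a. \<lbrakk>openin X U; a \<in> carrier (sect A U); \<phi> U a = \<one>\<^bsub>sect B U\<^esub>\<rbrakk>
      \<Longrightarrow> \<psi> U a = \<one>\<^bsub>sect C U\<^esub>"
begin

lemma kernel_le_eq:
  assumes W: "openin X W" and ab: "a \<in> carrier (sect A W)" "b \<in> carrier (sect A W)" "\<phi> W a = \<phi> W b"
  shows "\<psi> W a = \<psi> W b"
proof -
  have C': "presheaf X C" using C by (rule sheaf_imp_presheaf)
  interpret A: group "sect A W" using A W by (rule presheaf_group)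
  interpret B: group "sect B W" using B W by (rule presheaf_group)
  interpret C: group "sect C W" using C' W by (rule presheaf_group)
  note cl = psh_hom_closed[OF \<phi> W ab(1)] psh_hom_closed[OF \<phi> W ab(2)]
    psh_hom_closed[OF \<psi> W ab(1)] psh_hom_closed[OF \<psi> W ab(2)]
  have "\<phi> W (a \<otimes>\<^bsub>sect A W\<^esub> inv\<^bsub>sect A W\<^esub> b) = \<one>\<^bsub>sect B W\<^esub>"
    using ab cl by (simp add: psh_hom_mult[OF \<phi> W] psh_hom_inv[OF \<phi> A B W])
  then have "\<psi> W (a \<otimes>\<^bsub>sect A W\<^esub> inv\<^bsub>sect A W\<^esub> b) = \<one>\<^bsub>sect C W\<^esub>"
    using ker[OF W] ab by simp
  then have "\<psi> W a \<otimes>\<^bsub>sect C W\<^esub> inv\<^bsub>sect C W\<^esub> \<psi> W b = \<one>\<^bsub>sect C W\<^esub>"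
    using ab by (simp add: psh_hom_mult[OF \<psi> W] psh_hom_inv[OF \<psi> A C' W])
  then show ?thesis using cl C.inv_solve_right' C.l_one by (metis C.one_closed)
qed

text \<open>The values of \<psi> on local preimages of \<open>t\<close> agree on overlaps, because
  two preimages differ by an element of the kernel of \<phi>, which \<psi> kills. Since
  \<open>C\<close> is a sheaf they glue to \<open>c\<close>.\<close>

lemma descend_section:
  assumes U: "openin X U" and t: "t \<in> image_sections X A \<phi> B U"
  obtains c where "c \<in> carrier (sect C U)"
    "\<And>W a. \<lbrakk>openin X W; W \<subseteq> U; a \<in> carrier (sect A W); \<phi> W a = res B U W t\<rbrakk>
      \<Longrightarrow> res C U W c = \<psi> W a"
proof -
  let ?W = "{W. openin X W \<and> W \<subseteq> U \<and> res B U W t \<in> \<phi> W ` carrier (sect A W)}"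
  have tB: "t \<in> carrier (sect B U)" using t by (simp add: image_sections_def)
  have UW: "\<Union>?W = U"
  proof
    show "U \<subseteq> \<Union>?W"
    proof
      fix x assume "x \<in> U"
      from image_sectionsE[OF t this] obtain W a where "openin X W" "x \<in> W" "W \<subseteq> U"
        "a \<in> carrier (sect A W)" "res B U W t = \<phi> W a" .
      then show "x \<in> \<Union>?W" by blast
    qed
  qed blast
  \<comment> \<open>An arbitrary choice of local preimages; by \<open>kernel_le_eq\<close> the
    values of \<psi> do not depend on it.\<close>
  define s where "s W = (SOME a. a \<in> carrier (sect A W) \<and> \<phi> W a = res B U W t)" for W
  have s: "s W \<in> carrier (sect A W)" "\<phi> W (s W) = res B U W t" if "W \<in> ?W" for W
  proof -
    have "\<exists>a. a \<in> carrier (sect A W) \<and> \<phi> W a = res B U W t" using that by auto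
    from someI_ex[OF this] show "s W \<in> carrier (sect A W)" "\<phi> W (s W) = res B U W t"
      by (simp_all add: s_def)
  qed
  have res_s: "\<phi> W' (res A W W' (s W)) = res B U W' t" "res A W W' (s W) \<in> carrier (sect A W')"
    "res C W W' (\<psi> W (s W)) = \<psi> W' (res A W W' (s W))"
    if "W \<in> ?W" "openin X W'" "W' \<subseteq> W" for W W'
    using that s[OF that(1)] psh_hom_res[OF \<phi>, of W W'] psh_hom_res[OF \<psi>, of W W']
      presheaf_res_closed[OF A, of W W'] presheaf_res_res[OF B U _ _ _ _ tB, of W W'] by auto
  have "\<exists>!c. c \<in> carrier (sect C (\<Union>?W)) \<and> (\<forall>W\<in>?W. res C (\<Union>?W) W c = \<psi> W (s W))"
  proof (rule sheaf_unique_glue[OF C])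
    show "openin X W \<and> \<psi> W (s W) \<in> carrier (sect C W)" if "W \<in> ?W" for W
      using that s(1)[OF that] psh_hom_closed[OF \<psi>] by blast
  next
    fix W W' assume W: "W \<in> ?W" and W': "W' \<in> ?W"
    have I: "openin X (W \<inter> W')" "W \<inter> W' \<subseteq> W" "W \<inter> W' \<subseteq> W'" using W W' by (auto intro: openin_Int)
    show "res C W (W \<inter> W') (\<psi> W (s W)) = res C W' (W \<inter> W') (\<psi> W' (s W'))"
      using kernel_le_eq[OF I(1) res_s(2)[OF W I(1,2)] res_s(2)[OF W' I(1,3)]]
        res_s(1,3)[OF W I(1,2)] res_s(1,3)[OF W' I(1,3)] by simp
  qed
  then obtain c where c: "c \<in> carrier (sect C U)" "\<And>W. W \<in> ?W \<Longrightarrow> res C U W c = \<psi> W (s W)"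
    using UW by auto
  show ?thesis
  proof
    show "c \<in> carrier (sect C U)" by fact
    fix W a assume W: "openin X W" "W \<subseteq> U" and a: "a \<in> carrier (sect A W)" "\<phi> W a = res B U W t"
    then have "W \<in> ?W" by force
    then show "res C U W c = \<psi> W a"
      using kernel_le_eq[OF W(1) s(1) a(1)] c(2) s(2) a(2) by simp
  qed
qed

text \<open>The image sheaf has the universal property of the quotient of \<open>A\<close> by the
  kernel of \<phi>. Naturality and additivity of \<chi> are checked on neighbourhoods where
  preimages exist.\<close>

lemma descend_hom:
  obtains \<chi> where "\<chi> \<in> psh_hom X (image_psh X A \<phi> B) C"
    "\<And>U a. \<lbrakk>openin X U; a \<in> carrier (sect A U)\<rbrakk> \<Longrightarrow> \<chi> U (\<phi> U a) = \<psi> U a"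
proof -
  have C': "presheaf X C" using C by (rule sheaf_imp_presheaf)
  \<comment> \<open>The chosen \<open>c\<close> keeps its relation to every local preimage at once;
    the later computations with \<chi> all go through this relation.\<close>
  have "\<forall>U t. \<exists>c. openin X U \<and> t \<in> image_sections X A \<phi> B U \<longrightarrow> c \<in> carrier (sect C U) \<and>
    (\<forall>W a. openin X W \<and> W \<subseteq> U \<and> a \<in> carrier (sect A W) \<and> \<phi> W a = res B U W t \<longrightarrow>
      res C U W c = \<psi> W a)"
    using descend_section by metis
  then obtain \<chi> where "\<forall>U t. openin X U \<and> t \<in> image_sections X A \<phi> B U \<longrightarrow> \<chi> U t \<in> carrier (sect C U) \<and>
    (\<forall>W a. openin X W \<and> W \<subseteq> U \<and> a \<in> carrier (sect A W) \<and> \<phi> W a = res B U W t \<longrightarrow>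
      res C U W (\<chi> U t) = \<psi> W a)"
    by metis
  then have \<chi>: "\<And>U t. \<lbrakk>openin X U; t \<in> image_sections X A \<phi> B U\<rbrakk> \<Longrightarrow> \<chi> U t \<in> carrier (sect C U)"
    and loc: "\<And>U t W a. \<lbrakk>openin X U; t \<in> image_sections X A \<phi> B U; openin X W; W \<subseteq> U;
      a \<in> carrier (sect A W); \<phi> W a = res B U W t\<rbrakk> \<Longrightarrow> res C U W (\<chi> U t) = \<psi> W a"
    by blast+
  have sub: "t \<in> carrier (sect B U)" if "t \<in> image_sections X A \<phi> B U" for t U
    using that by (simp add: image_sections_def)
  have res_in: "res B U W t \<in> image_sections X A \<phi> B W"
    if "openin X U" "openin X W" "W \<subseteq> U" "t \<in> image_sections X A \<phi> B U" for U W t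
    using image_sections_res that .
  have nat: "\<chi> W (res B U W t) = res C U W (\<chi> U t)"
    if UW: "openin X U" "openin X W" "W \<subseteq> U" and t: "t \<in> image_sections X A \<phi> B U" for U W t
  proof (rule sheaf_local_eq[OF C UW(2)])
    show "\<chi> W (res B U W t) \<in> carrier (sect C W)" using \<chi> UW(2) res_in[OF UW t] by blast
    show "res C U W (\<chi> U t) \<in> carrier (sect C W)"
      using presheaf_res_closed[OF C' UW] \<chi>[OF UW(1) t] by blast
  next
    fix x assume x: "x \<in> W"
    obtain V a where V: "openin X V" "x \<in> V" "V \<subseteq> W"
      and a: "a \<in> carrier (sect A V)" "res B W V (res B U W t) = \<phi> V a"
      using image_sectionsE[OF res_in[OF UW t] x] .
    have "res B U V t = \<phi> V a" using a(2) presheaf_res_res[OF B UW(1,2) V(1,3) UW(3) sub[OF t]] by simp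
    then have "res C W V (\<chi> W (res B U W t)) = res C W V (res C U W (\<chi> U t))"
      using loc[OF UW(2) res_in[OF UW t] V(1,3) a(1)] a(2) loc[OF UW(1) t V(1) _ a(1)] V UW
        presheaf_res_res[OF C' UW(1,2) V(1,3) UW(3) \<chi>[OF UW(1) t]] by simp
    then show "\<exists>V. openin X V \<and> x \<in> V \<and> V \<subseteq> W \<and>
        res C W V (\<chi> W (res B U W t)) = res C W V (res C U W (\<chi> U t))"
      using V by blast
  qed
  have mult: "\<chi> U (s \<otimes>\<^bsub>sect B U\<^esub> t) = \<chi> U s \<otimes>\<^bsub>sect C U\<^esub> \<chi> U t"
    if U: "openin X U" and s: "s \<in> image_sections X A \<phi> B U" and t: "t \<in> image_sections X A \<phi> B U"
    for U s t
  proof (rule sheaf_local_eq[OF C U])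
    interpret C: group "sect C U" using C' U by (rule presheaf_group)
    have st: "s \<otimes>\<^bsub>sect B U\<^esub> t \<in> image_sections X A \<phi> B U"
      using subgroup_image_sections[OF U] s t by (rule subgroup.m_closed)
    then show "\<chi> U (s \<otimes>\<^bsub>sect B U\<^esub> t) \<in> carrier (sect C U)" using \<chi> U by blast
    show "\<chi> U s \<otimes>\<^bsub>sect C U\<^esub> \<chi> U t \<in> carrier (sect C U)" using \<chi>[OF U] s t by simp
    fix x assume x: "x \<in> U"
    obtain V a' where V: "openin X V" "x \<in> V" "V \<subseteq> U"
      and a': "a' \<in> carrier (sect A V)" "res B U V s = \<phi> V a'"
      using image_sectionsE[OF s x] .
    \<comment> \<open>Shrinking inside \<open>V\<close> gives one neighbourhood on which both
      \<open>s\<close> and \<open>t\<close> have preimages.\<close>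
    obtain W b where W: "openin X W" "x \<in> W" "W \<subseteq> V"
      and b: "b \<in> carrier (sect A W)" "res B V W (res B U V t) = \<phi> W b"
      using image_sectionsE[OF res_in[OF U V(1,3) t] V(2)] .
    define a where "a = res A V W a'"
    have WU: "W \<subseteq> U" using W V by blast
    have a: "a \<in> carrier (sect A W)" "res B U W s = \<phi> W a"
      using presheaf_res_closed[OF A V(1) W(1,3) a'(1)] psh_hom_res[OF \<phi> V(1) W(1,3) a'(1)] a'(2)
        presheaf_res_res[OF B U V(1) W(1,3) V(3) sub[OF s]] by (auto simp: a_def)
    have b': "res B U W t = \<phi> W b"
      using b(2) presheaf_res_res[OF B U V(1) W(1,3) V(3) sub[OF t]] by simp
    interpret A: group "sect A W" using A W(1) by (rule presheaf_group)
    have "\<phi> W (a \<otimes>\<^bsub>sect A W\<^esub> b) = res B U W (s \<otimes>\<^bsub>sect B U\<^esub> t)"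
      using psh_hom_mult[OF \<phi> W(1) a(1) b(1)] presheaf_res_mult[OF B U W(1) WU sub[OF s] sub[OF t]]
        a(2) b' by simp
    then have "res C U W (\<chi> U (s \<otimes>\<^bsub>sect B U\<^esub> t)) = \<psi> W (a \<otimes>\<^bsub>sect A W\<^esub> b)"
      using loc[OF U st W(1) WU] a b by simp
    also have "\<dots> = res C U W (\<chi> U s) \<otimes>\<^bsub>sect C W\<^esub> res C U W (\<chi> U t)"
      using psh_hom_mult[OF \<psi> W(1) a(1) b(1)] loc[OF U s W(1) WU a(1)] loc[OF U t W(1) WU b(1)] a b'
      by simp
    finally show "\<exists>W. openin X W \<and> x \<in> W \<and> W \<subseteq> U \<and>
        res C U W (\<chi> U (s \<otimes>\<^bsub>sect B U\<^esub> t)) = res C U W (\<chi> U s \<otimes>\<^bsub>sect C U\<^esub> \<chi> U t)"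
      using W WU presheaf_res_mult[OF C' U W(1) WU] \<chi>[OF U s] \<chi>[OF U t] by auto
  qed
  show ?thesis
  proof
    show "\<chi> \<in> psh_hom X (image_psh X A \<phi> B) C"
      using \<chi> nat mult by (intro psh_homI) (auto simp: image_psh_def hom_def)
    fix U a assume U: "openin X U" and a: "a \<in> carrier (sect A U)"
    then show "\<chi> U (\<phi> U a) = \<psi> U a"
      using loc[OF U image_sections_image[OF U a] U _ a] presheaf_res_self[OF B U psh_hom_closed[OF \<phi> U a]]
        presheaf_res_self[OF C' U \<chi>[OF U image_sections_image[OF U a]]] by simp
  qed
qed

end

end

text \<open>\<psi> factors through the image sheaf of \<phi>, and the inclusion of that sheaf into
  \<open>B\<close> is a monomorphism of \<open>univ\<close>-valued sheaves, to which the definition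
  of injectivity applies. This covers \<phi> = \<epsilon>, with source \<open>F\<close> of another
  value type, and \<phi> = \<open>d n\<close>, which has a kernel.\<close>

lemma injective_sheaf_extend:
  fixes X :: "'x topology" and B J :: "('x, ('x, 'b) univ) psh" and A :: "('x, 'd) psh"
  assumes J: "injective_sheaf X J" and B: "sheaf X B" and A: "presheaf X A"
    and \<phi>: "\<phi> \<in> psh_hom X A B" and \<psi>: "\<psi> \<in> psh_hom X A J"
    and ker: "\<And>U a. \<lbrakk>openin X U; a \<in> carrier (sect A U); \<phi> U a = \<one>\<^bsub>sect B U\<^esub>\<rbrakk>
      \<Longrightarrow> \<psi> U a = \<one>\<^bsub>sect J U\<^esub>"
  obtains g where "g \<in> psh_hom X B J"
    "\<And>U a. \<lbrakk>openin X U; a \<in> carrier (sect A U)\<rbrakk> \<Longrightarrow> g U (\<phi> U a) = \<psi> U a"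
proof -
  have B': "presheaf X B" using B by (rule sheaf_imp_presheaf)
  let ?I = "image_psh X A \<phi> B"
  obtain \<chi> where \<chi>: "\<chi> \<in> psh_hom X ?I J"
    and eq: "\<And>U a. \<lbrakk>openin X U; a \<in> carrier (sect A U)\<rbrakk> \<Longrightarrow> \<chi> U (\<phi> U a) = \<psi> U a"
    using descend_hom[OF A B' \<phi> injective_imp_sheaf[OF J] \<psi> ker] by blast
  obtain g where g: "g \<in> psh_hom X B J" "\<And>U a. \<lbrakk>openin X U; a \<in> carrier (sect ?I U)\<rbrakk> \<Longrightarrow> g U a = \<chi> U a"
    using J[unfolded injective_sheaf_def, THEN conjunct2, rule_format,
        OF image_psh_inclusion[OF A B' \<phi>] \<chi> conjI[OF sheaf_image_psh[OF A B' \<phi> B] B]] by auto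
  have "g U (\<phi> U a) = \<psi> U a" if "openin X U" "a \<in> carrier (sect A U)" for U a
    using g(2)[OF that(1)] image_sections_image[OF A B' \<phi> that] eq[OF that] by (simp add: image_psh_def)
  then show ?thesis using that g(1) by blast
qed

text \<open>By exactness \<open>t\<close> is locally in the image of \<phi>, where \<theta> is
  trivial, and triviality is local. This supplies the kernel condition of
  \<open>injective_sheaf_extend\<close> along a resolution.\<close>

lemma sheaf_exact_at_kill:
  assumes ex: "sheaf_exact_at X A \<phi> B \<psi> C" and B: "presheaf X B" and D: "sheaf X D"
    and \<theta>: "\<theta> \<in> psh_hom X B D"
    and U: "openin X U" and t: "t \<in> carrier (sect B U)" "\<psi> U t = \<one>\<^bsub>sect C U\<^esub>"
    and zero: "\<And>U a. \<lbrakk>openin X U; a \<in> carrier (sect A U)\<rbrakk> \<Longrightarrow> \<theta> U (\<phi> U a) = \<one>\<^bsub>sect D U\<^esub>"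
  shows "\<theta> U t = \<one>\<^bsub>sect D U\<^esub>"
proof (rule sheaf_local_eq[OF D U])
  have D': "presheaf X D" using D by (rule sheaf_imp_presheaf)
  show "\<theta> U t \<in> carrier (sect D U)" using psh_hom_closed[OF \<theta> U t(1)] .
  show "\<one>\<^bsub>sect D U\<^esub> \<in> carrier (sect D U)"
    using presheaf_group[OF D' U] by (simp add: group.is_monoid)
  fix x assume x: "x \<in> U"
  have "t \<in> image_sections X A \<phi> B U"
    using ex t U by (simp add: sheaf_exact_at_iff)
  from image_sectionsE[OF this x] obtain W a where W: "openin X W" "x \<in> W" "W \<subseteq> U"
    and a: "a \<in> carrier (sect A W)" "res B U W t = \<phi> W a"
    by blast
  then have "res D U W (\<theta> U t) = res D U W \<one>\<^bsub>sect D U\<^esub>"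
    using psh_hom_res[OF \<theta> U W(1,3) t(1)] zero[OF W(1) a(1)] presheaf_res_one[OF D' U W(1,3)] by simp
  then show "\<exists>W. openin X W \<and> x \<in> W \<and> W \<subseteq> U \<and> res D U W (\<theta> U t) = res D U W \<one>\<^bsub>sect D U\<^esub>"
    using W by blast
qed

lemma sheaf_exact_at_zero:
  assumes "sheaf_exact_at X A \<phi> B \<psi> C" "presheaf X A" "presheaf X B" "\<phi> \<in> psh_hom X A B"
    and "openin X U" "a \<in> carrier (sect A U)"
  shows "\<psi> U (\<phi> U a) = \<one>\<^bsub>sect C U\<^esub>"
  using assms image_sections_image[OF assms(2-6)] unfolding sheaf_exact_at_iff
  by (auto simp: image_sections_def)

section \<open>Comparison of injective resolutions\<close>

lemma
  assumes "injective_resolution X F \<epsilon> I d"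
  shows resolution_injective: "injective_sheaf X (I n)"
    and resolution_sheaf: "sheaf X (I n)"
    and resolution_presheaf: "presheaf X (I n)"
    and resolution_aug_mono: "\<epsilon> \<in> psh_mono X F (I 0)"
    and resolution_aug_hom: "\<epsilon> \<in> psh_hom X F (I 0)"
    and resolution_d_hom: "d n \<in> psh_hom X (I n) (I (Suc n))"
    and resolution_exact_0: "sheaf_exact_at X F \<epsilon> (I 0) (d 0) (I (Suc 0))"
    and resolution_exact: "sheaf_exact_at X (I n) (d n) (I (Suc n)) (d (Suc n)) (I (Suc (Suc n)))"
  using assms injective_imp_sheaf[of X "I n"] sheaf_imp_presheaf[of X "I n"]
  by (simp_all add: injective_resolution_def psh_mono_def)

lemma resolution_dd:
  assumes "injective_resolution X F \<epsilon> I d" "openin X U" "a \<in> carrier (sect (I n) U)"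
  shows "d (Suc n) U (d n U a) = \<one>\<^bsub>sect (I (Suc (Suc n))) U\<^esub>"
  by (rule sheaf_exact_at_zero[OF resolution_exact[OF assms(1)] resolution_presheaf[OF assms(1)]
        resolution_presheaf[OF assms(1)] resolution_d_hom[OF assms(1)] assms(2,3)])

lemma resolution_d_aug:
  assumes "injective_resolution X F \<epsilon> I d" "presheaf X F" "openin X U" "a \<in> carrier (sect F U)"
  shows "d 0 U (\<epsilon> U a) = \<one>\<^bsub>sect (I (Suc 0)) U\<^esub>"
  by (rule sheaf_exact_at_zero[OF resolution_exact_0[OF assms(1)] assms(2)
        resolution_presheaf[OF assms(1)] resolution_aug_hom[OF assms(1)] assms(3,4)])

text \<open>Comparison theorem: injectivity of \<open>J (Suc n)\<close> extends \<open>e n\<close>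
  after \<open>f n\<close> along \<open>d n\<close>, degree by degree. The kernel of
  \<open>d n\<close> is killed because it is locally the image of the preceding map.\<close>

lemma resolution_chain_map:
  fixes F :: "('x, 'b) psh"
  assumes F: "presheaf X F"
    and I: "injective_resolution X F \<epsilon> I d" and J: "injective_resolution X F \<eta> J e"
  obtains f where "\<And>n. f n \<in> psh_hom X (I n) (J n)"
    "\<And>U a. \<lbrakk>openin X U; a \<in> carrier (sect F U)\<rbrakk> \<Longrightarrow> f 0 U (\<epsilon> U a) = \<eta> U a"
    "\<And>n U a. \<lbrakk>openin X U; a \<in> carrier (sect (I n) U)\<rbrakk> \<Longrightarrow> f (Suc n) U (d n U a) = e n U (f n U a)"
proof -
  note Is = resolution_sheaf[OF I] and Ip = resolution_presheaf[OF I] and dh = resolution_d_hom[OF I]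
  note Jp = resolution_presheaf[OF J] and eh = resolution_d_hom[OF J]
  \<comment> \<open>Besides \<open>f\<close>, \<open>P\<close> carries the kernel condition that
    permits the next extension. Compatibility with the augmentations is guarded by
    \<open>n = 0\<close>, since one predicate has to serve for all degrees.\<close>
  define P where "P n f \<longleftrightarrow> f \<in> psh_hom X (I n) (J n) \<and>
    (\<forall>U a. openin X U \<longrightarrow> a \<in> carrier (sect (I n) U) \<longrightarrow> d n U a = \<one>\<^bsub>sect (I (Suc n)) U\<^esub> \<longrightarrow>
      e n U (f U a) = \<one>\<^bsub>sect (J (Suc n)) U\<^esub>) \<and>
    (n = 0 \<longrightarrow> (\<forall>U a. openin X U \<longrightarrow> a \<in> carrier (sect F U) \<longrightarrow> f U (\<epsilon> U a) = \<eta> U a))" for n f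
  define Q where "Q n f g \<longleftrightarrow> (\<forall>U a. openin X U \<longrightarrow> a \<in> carrier (sect (I n) U) \<longrightarrow>
    g U (d n U a) = e n U (f U a))" for n f and g :: "'x set \<Rightarrow> ('x, 'b) univ \<Rightarrow> ('x, 'b) univ"
  have "\<exists>f. \<forall>n. P n (f n) \<and> Q n (f n) (f (Suc n))"
  proof (rule dependent_nat_choice)
    \<comment> \<open>In degree 0 the extension is made along \<epsilon>, whose injectivity gives
      the kernel condition.\<close>
    have "\<eta> U a = \<one>\<^bsub>sect (J 0) U\<^esub>"
      if U: "openin X U" and a: "a \<in> carrier (sect F U)" "\<epsilon> U a = \<one>\<^bsub>sect (I 0) U\<^esub>" for U a
    proof -
      interpret group "sect F U" using F U by (rule presheaf_group)
      have "inj_on (\<epsilon> U) (carrier (sect F U))"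
        using resolution_aug_mono[OF I] U by (simp add: psh_mono_def)
      moreover have "\<epsilon> U \<one>\<^bsub>sect F U\<^esub> = \<epsilon> U a"
        using a(2) psh_hom_one[OF resolution_aug_hom[OF I] F Ip U] by simp
      ultimately have "a = \<one>\<^bsub>sect F U\<^esub>" using a(1) by (metis inj_onD one_closed)
      then show ?thesis using psh_hom_one[OF resolution_aug_hom[OF J] F Jp U] by simp
    qed
    from injective_sheaf_extend[OF resolution_injective[OF J] Is F resolution_aug_hom[OF I]
        resolution_aug_hom[OF J] this]
    obtain f where f: "f \<in> psh_hom X (I 0) (J 0)"
      and aug: "\<And>U a. \<lbrakk>openin X U; a \<in> carrier (sect F U)\<rbrakk> \<Longrightarrow> f U (\<epsilon> U a) = \<eta> U a"
      by metis
    have "e 0 U (f U a) = \<one>\<^bsub>sect (J (Suc 0)) U\<^esub>"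
      if "openin X U" "a \<in> carrier (sect (I 0) U)" "d 0 U a = \<one>\<^bsub>sect (I (Suc 0)) U\<^esub>" for U a
      using sheaf_exact_at_kill[OF resolution_exact_0[OF I] Ip resolution_sheaf[OF J]
          psh_hom_comp[OF f eh], OF that] aug resolution_d_aug[OF J F] by simp
    then show "\<exists>f. P 0 f" using f aug unfolding P_def by blast
  next
    fix f n assume f: "P n f"
    then have fh: "f \<in> psh_hom X (I n) (J n)" by (simp add: P_def)
    have ker: "e n U (f U a) = \<one>\<^bsub>sect (J (Suc n)) U\<^esub>"
      if "openin X U" "a \<in> carrier (sect (I n) U)" "d n U a = \<one>\<^bsub>sect (I (Suc n)) U\<^esub>" for U a
      using f that by (simp add: P_def)
    obtain g where g: "g \<in> psh_hom X (I (Suc n)) (J (Suc n))"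
      and gd: "\<And>U a. \<lbrakk>openin X U; a \<in> carrier (sect (I n) U)\<rbrakk> \<Longrightarrow> g U (d n U a) = e n U (f U a)"
      using injective_sheaf_extend[OF resolution_injective[OF J] Is Ip dh psh_hom_comp[OF fh eh] ker]
      by metis
    \<comment> \<open>Exactness at \<open>I (Suc n)\<close> reduces the new kernel condition to
      boundaries, where two successive differentials of \<open>J\<close> appear.\<close>
    have "e (Suc n) U (g U a) = \<one>\<^bsub>sect (J (Suc (Suc n))) U\<^esub>"
      if "openin X U" "a \<in> carrier (sect (I (Suc n)) U)" "d (Suc n) U a = \<one>\<^bsub>sect (I (Suc (Suc n))) U\<^esub>"
      for U a
      using sheaf_exact_at_kill[OF resolution_exact[OF I] Ip resolution_sheaf[OF J]
          psh_hom_comp[OF g eh], OF that] gd resolution_dd[OF J] psh_hom_closed[OF fh] by simp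
    then have "P (Suc n) g" "Q n f g" using g gd unfolding P_def Q_def by auto
    then show "\<exists>g. P (Suc n) g \<and> Q n f g" by blast
  qed
  then obtain f where f: "\<And>n. P n (f n)" "\<And>n. Q n (f n) (f (Suc n))" by blast
  show ?thesis
    by (rule that[of f]) (use f in \<open>auto simp: P_def Q_def\<close>)
qed

text \<open>The quotient \<open>u / id\<close> is a chain map over the trivial endomorphism of \<open>F\<close>, hence null-homotopic.\<close>

lemma resolution_chain_endo:
  assumes F: "presheaf X F" and I: "injective_resolution X F \<epsilon> I d"
    and u: "\<And>n. u n \<in> psh_hom X (I n) (I n)"
    and U: "openin X U" and z: "z \<in> carrier (sect (I (Suc n)) U)"
      "d (Suc n) U z = \<one>\<^bsub>sect (I (Suc (Suc n))) U\<^esub>"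
    and u_aug: "\<And>U a. \<lbrakk>openin X U; a \<in> carrier (sect F U)\<rbrakk> \<Longrightarrow> u 0 U (\<epsilon> U a) = \<epsilon> U a"
    and u_d: "\<And>n U a. \<lbrakk>openin X U; a \<in> carrier (sect (I n) U)\<rbrakk>
      \<Longrightarrow> u (Suc n) U (d n U a) = d n U (u n U a)"
  obtains b where "b \<in> carrier (sect (I n) U)"
    "u (Suc n) U z = d n U b \<otimes>\<^bsub>sect (I (Suc n)) U\<^esub> z"
proof -
  note Is = resolution_sheaf[OF I] and Ip = resolution_presheaf[OF I] and dh = resolution_d_hom[OF I]
  note grp = presheaf_comm_group[OF Ip]
  define w where "w n U s = u n U s \<otimes>\<^bsub>sect (I n) U\<^esub> inv\<^bsub>sect (I n) U\<^esub> s" for n U s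
  have id: "(\<lambda>U s. s) \<in> psh_hom X (I n) (I n)" for n
    by (simp add: psh_hom_def hom_def)
  have w: "w n \<in> psh_hom X (I n) (I n)" for n
    using psh_hom_div[OF u id Ip] by (simp add: w_def[abs_def])
  have w_aug: "w 0 U (\<epsilon> U a) = \<one>\<^bsub>sect (I 0) U\<^esub>" if "openin X U" "a \<in> carrier (sect F U)" for U a
    using group.r_inv[OF presheaf_group[OF Ip that(1)] psh_hom_closed[OF resolution_aug_hom[OF I] that]]
      u_aug[OF that] by (simp add: w_def)
  have w_d: "w (Suc n) U (d n U a) = d n U (w n U a)"
    if a: "openin X U" "a \<in> carrier (sect (I n) U)" for n U a
  proof -
    interpret group "sect (I n) U" using Ip a(1) by (rule presheaf_group)
    show ?thesis
      using a(2) psh_hom_closed[OF u a] by (simp add: w_def u_d[OF a] psh_hom_mult[OF dh a(1)]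
          psh_hom_inv[OF dh Ip Ip a(1)])
  qed
  define \<theta> where "\<theta> n h U s = w (Suc n) U s \<otimes>\<^bsub>sect (I (Suc n)) U\<^esub>
      inv\<^bsub>sect (I (Suc n)) U\<^esub> d n U (h U s)" for n h U s
  \<comment> \<open>The homotopy equation in degree \<open>n\<close> after applying
    \<open>d n\<close>, which removes the term with the preceding homotopy. Each inductive step thus
    involves a single \<open>h\<close>.\<close>
  define htpy where "htpy n h \<longleftrightarrow> h \<in> psh_hom X (I (Suc n)) (I n) \<and>
    (\<forall>U a. openin X U \<longrightarrow> a \<in> carrier (sect (I n) U) \<longrightarrow> d n U (h U (d n U a)) = d n U (w n U a))" for n h
  have \<theta>: "\<theta> n h \<in> psh_hom X (I (Suc n)) (I (Suc n))" if "htpy n h" for n h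
    using psh_hom_div[OF w psh_hom_comp[OF _ dh] Ip, of h n] that
    by (simp add: \<theta>_def[abs_def] htpy_def)
  \<comment> \<open>\<theta> is trivial on boundaries by \<open>htpy\<close> and hence, by
    exactness, on all cocycles. On a cocycle \<open>z\<close> this says that
    \<open>w (Suc n) U z\<close> is the boundary of \<open>h U z\<close>.\<close>
  have kill: "\<theta> n h U t = \<one>\<^bsub>sect (I (Suc n)) U\<^esub>"
    if h: "htpy n h" and t: "openin X U" "t \<in> carrier (sect (I (Suc n)) U)"
      "d (Suc n) U t = \<one>\<^bsub>sect (I (Suc (Suc n))) U\<^esub>" for n h U t
  proof (rule sheaf_exact_at_kill[OF resolution_exact[OF I] Ip Is \<theta>[OF h], OF t])
    fix U a assume a: "openin X U" "a \<in> carrier (sect (I n) U)"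
    interpret group "sect (I (Suc n)) U" using Ip a(1) by (rule presheaf_group)
    show "\<theta> n h U (d n U a) = \<one>\<^bsub>sect (I (Suc n)) U\<^esub>"
      using h a psh_hom_closed[OF dh a(1) psh_hom_closed[OF w a]]
      by (simp add: \<theta>_def htpy_def w_d[OF a])
  qed
  have "\<exists>h. htpy n h" for n
  proof (induction n)
    case 0
    have "w 0 U a = \<one>\<^bsub>sect (I 0) U\<^esub>"
      if "openin X U" "a \<in> carrier (sect (I 0) U)" "d 0 U a = \<one>\<^bsub>sect (I (Suc 0)) U\<^esub>" for U a
      using sheaf_exact_at_kill[OF resolution_exact_0[OF I] Ip Is w, OF that w_aug] .
    from injective_sheaf_extend[OF resolution_injective[OF I] Is Ip dh w this]
    obtain h where "h \<in> psh_hom X (I (Suc 0)) (I 0)"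
      "\<And>U a. \<lbrakk>openin X U; a \<in> carrier (sect (I 0) U)\<rbrakk> \<Longrightarrow> h U (d 0 U a) = w 0 U a"
      by metis
    then show ?case by (auto simp: htpy_def)
  next
    case (Suc n)
    then obtain h where h: "htpy n h" by blast
    from injective_sheaf_extend[OF resolution_injective[OF I] Is Ip dh \<theta>[OF h] kill[OF h]]
    obtain k where k: "k \<in> psh_hom X (I (Suc (Suc n))) (I (Suc n))"
      "\<And>U a. \<lbrakk>openin X U; a \<in> carrier (sect (I (Suc n)) U)\<rbrakk> \<Longrightarrow> k U (d (Suc n) U a) = \<theta> n h U a"
      by metis
    have "d (Suc n) U (\<theta> n h U a) = d (Suc n) U (w (Suc n) U a)"
      if a: "openin X U" "a \<in> carrier (sect (I (Suc n)) U)" for U a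
    proof -
      interpret S: comm_group "sect (I (Suc n)) U" using a(1) by (rule grp)
      interpret SS: comm_group "sect (I (Suc (Suc n))) U" using a(1) by (rule grp)
      have ha: "h U a \<in> carrier (sect (I n) U)"
        using h psh_hom_closed[of h] a by (auto simp: htpy_def)
      show ?thesis
        using psh_hom_closed[OF w a] psh_hom_closed[OF dh a(1) ha] psh_hom_closed[OF dh a(1) psh_hom_closed[OF w a]]
        by (simp add: \<theta>_def psh_hom_mult[OF dh a(1)] psh_hom_inv[OF dh Ip Ip a(1)]
            resolution_dd[OF I a(1) ha])
    qed
    then have "htpy (Suc n) k" using k by (simp add: htpy_def)
    then show ?case by blast
  qed
  then obtain h where h: "htpy n h" by blast
  interpret comm_group "sect (I (Suc n)) U" using U by (rule grp)
  have hz: "h U z \<in> carrier (sect (I n) U)"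
    using h psh_hom_closed[of h] U z by (auto simp: htpy_def)
  have cl: "u (Suc n) U z \<in> carrier (sect (I (Suc n)) U)" "d n U (h U z) \<in> carrier (sect (I (Suc n)) U)"
    using psh_hom_closed[OF u U z(1)] psh_hom_closed[OF dh U hz] by auto
  have "(u (Suc n) U z \<otimes>\<^bsub>sect (I (Suc n)) U\<^esub> inv\<^bsub>sect (I (Suc n)) U\<^esub> z)
      \<otimes>\<^bsub>sect (I (Suc n)) U\<^esub> inv\<^bsub>sect (I (Suc n)) U\<^esub> d n U (h U z) = \<one>\<^bsub>sect (I (Suc n)) U\<^esub>"
    using kill[OF h U z] by (simp add: \<theta>_def w_def)
  then have "u (Suc n) U z \<otimes>\<^bsub>sect (I (Suc n)) U\<^esub> inv\<^bsub>sect (I (Suc n)) U\<^esub> z = d n U (h U z)"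
    using cl z(1) by (metis inv_closed inv_equality inv_inv m_closed)
  then have "u (Suc n) U z = d n U (h U z) \<otimes>\<^bsub>sect (I (Suc n)) U\<^esub> z"
    using cl z(1) by (metis inv_solve_right)
  then show ?thesis using that hz by blast
qed

text \<open>The comparison maps compose to chain endomorphisms over the identity of
  \<open>F\<close>, and by \<open>resolution_chain_endo\<close> these move a cocycle of positive
  degree only by a boundary.\<close>

lemma sheaf_cohomology_iso:
  fixes F :: "('x, 'b) psh"
  assumes F: "presheaf X F"
    and I: "injective_resolution X F \<epsilon> I d" and J: "injective_resolution X F \<eta> J e"
  shows "sheaf_cohomology X I d (Suc n) \<cong> sheaf_cohomology X J e (Suc n)"
proof -
  let ?S = "topspace X"
  have S: "openin X ?S" by simp
  have cyc: "comm_group ((sect (I (Suc n)) ?S)\<lparr>carrier :=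
      kernel (sect (I (Suc n)) ?S) (sect (I (Suc (Suc n))) ?S) (d (Suc n) ?S)\<rparr>)"
    "subgroup (boundaries (\<lambda>n. sect (I n) ?S) (\<lambda>n. d n ?S) (Suc n)) ((sect (I (Suc n)) ?S)\<lparr>carrier :=
      kernel (sect (I (Suc n)) ?S) (sect (I (Suc (Suc n))) ?S) (d (Suc n) ?S)\<rparr>)"
    if I: "injective_resolution X F \<epsilon> I d" for \<epsilon> I d
  proof -
    note grp = presheaf_comm_group[OF resolution_presheaf[OF I] S]
    note dh = psh_hom_hom[OF resolution_d_hom[OF I] S]
    show "comm_group ((sect (I (Suc n)) ?S)\<lparr>carrier :=
      kernel (sect (I (Suc n)) ?S) (sect (I (Suc (Suc n))) ?S) (d (Suc n) ?S)\<rparr>)"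
      by (rule comm_group_kernel[OF grp grp dh])
    show "subgroup (boundaries (\<lambda>n. sect (I n) ?S) (\<lambda>n. d n ?S) (Suc n)) ((sect (I (Suc n)) ?S)\<lparr>carrier :=
      kernel (sect (I (Suc n)) ?S) (sect (I (Suc (Suc n))) ?S) (d (Suc n) ?S)\<rparr>)"
      using subgroup_boundaries[of "\<lambda>n. sect (I n) ?S" "\<lambda>n. d n ?S" "Suc n"] grp dh
        resolution_dd[OF I S] by simp
  qed
  obtain f where f: "\<And>n. f n \<in> psh_hom X (I n) (J n)"
    "\<And>U a. \<lbrakk>openin X U; a \<in> carrier (sect F U)\<rbrakk> \<Longrightarrow> f 0 U (\<epsilon> U a) = \<eta> U a"
    "\<And>n U a. \<lbrakk>openin X U; a \<in> carrier (sect (I n) U)\<rbrakk> \<Longrightarrow> f (Suc n) U (d n U a) = e n U (f n U a)"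
    using resolution_chain_map[OF F I J] by metis
  obtain g where g: "\<And>n. g n \<in> psh_hom X (J n) (I n)"
    "\<And>U a. \<lbrakk>openin X U; a \<in> carrier (sect F U)\<rbrakk> \<Longrightarrow> g 0 U (\<eta> U a) = \<epsilon> U a"
    "\<And>n U a. \<lbrakk>openin X U; a \<in> carrier (sect (J n) U)\<rbrakk> \<Longrightarrow> g (Suc n) U (e n U a) = d n U (g n U a)"
    using resolution_chain_map[OF F J I] by metis
  note fc = psh_hom_closed[OF f(1) S] and gc = psh_hom_closed[OF g(1) S]
    and dc = psh_hom_closed[OF resolution_d_hom[OF I] S]
    and ec = psh_hom_closed[OF resolution_d_hom[OF J] S]
  note Ip = resolution_presheaf[OF I] and Jp = resolution_presheaf[OF J]
  note f1 = psh_hom_one[OF f(1) Ip Jp S] and g1 = psh_hom_one[OF g(1) Jp Ip S]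
  interpret IS: comm_group "sect (I (Suc n)) ?S" using Ip S by (rule presheaf_comm_group)
  have gf: "\<exists>b\<in>carrier (sect (I n) ?S). g (Suc n) ?S (f (Suc n) ?S z) = d n ?S b \<otimes>\<^bsub>sect (I (Suc n)) ?S\<^esub> z"
    if "z \<in> carrier (sect (I (Suc n)) ?S)" "d (Suc n) ?S z = \<one>\<^bsub>sect (I (Suc (Suc n))) ?S\<^esub>" for z
    by (rule resolution_chain_endo[OF F I psh_hom_comp[OF f(1) g(1)] S that])
      (use f(2,3) g(2,3) psh_hom_closed[OF f(1)] in auto)
  have fg: "\<exists>b\<in>carrier (sect (J n) ?S). f (Suc n) ?S (g (Suc n) ?S z) = e n ?S b \<otimes>\<^bsub>sect (J (Suc n)) ?S\<^esub> z"
    if "z \<in> carrier (sect (J (Suc n)) ?S)" "e (Suc n) ?S z = \<one>\<^bsub>sect (J (Suc (Suc n))) ?S\<^esub>" for z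
    by (rule resolution_chain_endo[OF F J psh_hom_comp[OF g(1) f(1)] S that])
      (use f(2,3) g(2,3) psh_hom_closed[OF g(1)] in auto)
  \<comment> \<open>The cocycles of \<open>I\<close> are the middle group, with the identity on one
    side and \<open>f\<close> on the other. The homotopy for \<open>f\<close> after \<open>g\<close>
    makes \<open>f\<close> onto modulo boundaries; the one for \<open>g\<close> after
    \<open>f\<close> makes it reflect boundaries.\<close>
  show ?thesis
    unfolding sheaf_cohomology_def cohomology_def
  proof (rule Mod_iso_zigzag[where p = "\<lambda>z. z" and q = "f (Suc n) ?S"])
    let ?ZI = "kernel (sect (I (Suc n)) ?S) (sect (I (Suc (Suc n))) ?S) (d (Suc n) ?S)"
    let ?ZJ = "kernel (sect (J (Suc n)) ?S) (sect (J (Suc (Suc n))) ?S) (e (Suc n) ?S)"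
    show "group ((sect (I (Suc n)) ?S)\<lparr>carrier := ?ZI\<rparr>)"
      using cyc[OF I] by (simp add: comm_group_def)
    show "(\<lambda>z. z) \<in> hom ((sect (I (Suc n)) ?S)\<lparr>carrier := ?ZI\<rparr>) ((sect (I (Suc n)) ?S)\<lparr>carrier := ?ZI\<rparr>)"
      by (simp add: hom_def)
    have "f (Suc n) ?S z \<in> ?ZJ" if "z \<in> ?ZI" for z
      using that f(3)[OF S, of z "Suc n"] fc f1 by (simp add: kernel_def)
    then show "f (Suc n) ?S \<in> hom ((sect (I (Suc n)) ?S)\<lparr>carrier := ?ZI\<rparr>) ((sect (J (Suc n)) ?S)\<lparr>carrier := ?ZJ\<rparr>)"
      using psh_hom_mult[OF f(1) S] by (simp add: hom_def kernel_def)
    show "\<exists>k\<in>carrier ((sect (I (Suc n)) ?S)\<lparr>carrier := ?ZI\<rparr>).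
        \<exists>m\<in>boundaries (\<lambda>n. sect (I n) ?S) (\<lambda>n. d n ?S) (Suc n).
          k = m \<otimes>\<^bsub>(sect (I (Suc n)) ?S)\<lparr>carrier := ?ZI\<rparr>\<^esub> z"
      if "z \<in> carrier ((sect (I (Suc n)) ?S)\<lparr>carrier := ?ZI\<rparr>)" for z
      using that subgroup.one_closed[OF cyc(2)[OF I]]
      by (intro bexI[of _ z] bexI[of _ "\<one>\<^bsub>sect (I (Suc n)) ?S\<^esub>"]) (simp_all add: kernel_def)
    show "\<exists>k\<in>carrier ((sect (I (Suc n)) ?S)\<lparr>carrier := ?ZI\<rparr>).
        \<exists>m\<in>boundaries (\<lambda>n. sect (J n) ?S) (\<lambda>n. e n ?S) (Suc n).
          f (Suc n) ?S k = m \<otimes>\<^bsub>(sect (J (Suc n)) ?S)\<lparr>carrier := ?ZJ\<rparr>\<^esub> z"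
      if "z \<in> carrier ((sect (J (Suc n)) ?S)\<lparr>carrier := ?ZJ\<rparr>)" for z
    proof -
      have z: "z \<in> carrier (sect (J (Suc n)) ?S)" "e (Suc n) ?S z = \<one>\<^bsub>sect (J (Suc (Suc n))) ?S\<^esub>"
        using that by (auto simp: kernel_def)
      have "g (Suc n) ?S z \<in> ?ZI"
        using z g(3)[OF S z(1)] gc g1 by (simp add: kernel_def)
      then show ?thesis using fg[OF z] by (auto simp: boundaries_def)
    qed
    show "z \<in> boundaries (\<lambda>n. sect (I n) ?S) (\<lambda>n. d n ?S) (Suc n) \<longleftrightarrow>
        f (Suc n) ?S z \<in> boundaries (\<lambda>n. sect (J n) ?S) (\<lambda>n. e n ?S) (Suc n)"
      if "z \<in> carrier ((sect (I (Suc n)) ?S)\<lparr>carrier := ?ZI\<rparr>)" for z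
    proof
      assume "z \<in> boundaries (\<lambda>n. sect (I n) ?S) (\<lambda>n. d n ?S) (Suc n)"
      then show "f (Suc n) ?S z \<in> boundaries (\<lambda>n. sect (J n) ?S) (\<lambda>n. e n ?S) (Suc n)"
        using f(3)[OF S] fc by (auto simp: boundaries_def)
    next
      assume "f (Suc n) ?S z \<in> boundaries (\<lambda>n. sect (J n) ?S) (\<lambda>n. e n ?S) (Suc n)"
      then obtain b where b: "b \<in> carrier (sect (J n) ?S)" "f (Suc n) ?S z = e n ?S b"
        by (auto simp: boundaries_def)
      have z: "z \<in> carrier (sect (I (Suc n)) ?S)" "d (Suc n) ?S z = \<one>\<^bsub>sect (I (Suc (Suc n))) ?S\<^esub>"
        using that by (auto simp: kernel_def)
      from gf[OF z] obtain c where c: "c \<in> carrier (sect (I n) ?S)"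
        "g (Suc n) ?S (f (Suc n) ?S z) = d n ?S c \<otimes>\<^bsub>sect (I (Suc n)) ?S\<^esub> z" by blast
      interpret I0: comm_group "sect (I n) ?S" using Ip S by (rule presheaf_comm_group)
      have "d n ?S (g n ?S b) = d n ?S c \<otimes>\<^bsub>sect (I (Suc n)) ?S\<^esub> z"
        using c b g(3)[OF S b(1)] by simp
      then have "z = inv\<^bsub>sect (I (Suc n)) ?S\<^esub> d n ?S c \<otimes>\<^bsub>sect (I (Suc n)) ?S\<^esub> d n ?S (g n ?S b)"
        using z(1) dc[OF c(1)] dc[OF gc[OF b(1)]] IS.inv_solve_left by metis
      also have "\<dots> = d n ?S (inv\<^bsub>sect (I n) ?S\<^esub> c \<otimes>\<^bsub>sect (I n) ?S\<^esub> g n ?S b)"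
        using c(1) gc[OF b(1)] psh_hom_mult[OF resolution_d_hom[OF I] S]
          psh_hom_inv[OF resolution_d_hom[OF I] Ip Ip S] by simp
      finally show "z \<in> boundaries (\<lambda>n. sect (I n) ?S) (\<lambda>n. d n ?S) (Suc n)"
        using c(1) gc[OF b(1)] by (simp add: boundaries_def)
    qed
  qed (use cyc I J in auto)
qed

section \<open>Restriction to an open set and extension by zero\<close>

text \<open>Equality of the records would be too strong, as values on sets that are not open are
  arbitrary. On the opens inside \<open>U\<close>, \<open>restrict_psh F U\<close> agrees with
  \<open>F\<close> and \<open>zero_extension A U\<close> with \<open>A\<close> in this weaker sense,
  which suffices to transport morphisms and exactness.\<close>

definition psh_eq_on :: "'x topology \<Rightarrow> ('x, 'b) psh \<Rightarrow> ('x, 'b) psh \<Rightarrow> bool" where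
  "psh_eq_on X F G \<longleftrightarrow> (\<forall>U. openin X U \<longrightarrow> sect F U = sect G U) \<and>
     (\<forall>U W. openin X U \<and> openin X W \<and> W \<subseteq> U \<longrightarrow> res F U W = res G U W)"

lemma psh_hom_cong:
  "\<lbrakk>psh_eq_on X F F'; psh_eq_on X G G'\<rbrakk> \<Longrightarrow> psh_hom X F G = psh_hom X F' G'"
  unfolding psh_hom_def psh_eq_on_def by (rule Collect_cong) (auto 4 3)

lemma psh_eq_on_refl: "psh_eq_on X F F"
  by (simp add: psh_eq_on_def)

lemma psh_mono_cong:
  assumes "psh_eq_on X F F'" "psh_eq_on X G G'"
  shows "psh_mono X F G = psh_mono X F' G'"
  using assms(1) psh_hom_cong[OF assms] by (auto simp: psh_mono_def psh_eq_on_def)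

lemma image_sections_cong:
  assumes "psh_eq_on X F F'" "psh_eq_on X G G'" "openin X U"
  shows "image_sections X F \<phi> G U = image_sections X F' \<phi> G' U"
  using assms unfolding image_sections_def psh_eq_on_def
  by (intro Collect_cong conj_cong ball_cong ex_cong1) auto

lemma sheaf_exact_at_cong:
  assumes "psh_eq_on X F F'" "psh_eq_on X G G'" "psh_eq_on X H H'"
  shows "sheaf_exact_at X F \<phi> G \<psi> H \<longleftrightarrow> sheaf_exact_at X F' \<phi> G' \<psi> H'"
  unfolding sheaf_exact_at_iff
  using assms(2,3) image_sections_cong[OF assms(1,2)] by (simp add: psh_eq_on_def cong: conj_cong)

text \<open>On all of \<open>X\<close>, \<open>restrict_psh F U\<close> is the direct image of the
  restriction of \<open>F\<close> to \<open>U\<close>. A family over a cover is glued in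
  \<open>F\<close> over the intersections with \<open>U\<close>.\<close>

lemma sheaf_restrict_psh:
  assumes F: "sheaf X F" and U: "openin X U"
  shows "sheaf X (restrict_psh F U)"
  unfolding sheaf_def
proof (intro conjI allI impI)
  let ?R = "restrict_psh F U"
  have P: "presheaf X F" using F by (rule sheaf_imp_presheaf)
  have op: "openin X (U \<inter> W)" if "openin X W" for W using U that by (rule openin_Int)
  show "presheaf X ?R"
    unfolding presheaf_def
  proof (intro conjI allI impI ballI)
    show "comm_group (sect ?R W)" if "openin X W" for W
      using presheaf_comm_group[OF P op[OF that]] by (simp add: restrict_psh_def)
    show "res ?R W W' \<in> hom (sect ?R W) (sect ?R W')"
      if "openin X W \<and> openin X W' \<and> W' \<subseteq> W" for W W'
      using presheaf_res_hom[OF P op op, of W W'] that by (auto simp: restrict_psh_def)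
    show "res ?R W W s = s" if "openin X W" "s \<in> carrier (sect ?R W)" for W s
      using presheaf_res_self[OF P op[OF that(1)]] that(2) by (simp add: restrict_psh_def)
    show "res ?R W' W'' (res ?R W W' s) = res ?R W W'' s"
      if "openin X W \<and> openin X W' \<and> openin X W'' \<and> W'' \<subseteq> W' \<and> W' \<subseteq> W" "s \<in> carrier (sect ?R W)"
      for W W' W'' s
      using presheaf_res_res[OF P op op op, of W W' W''] that by (auto simp: restrict_psh_def)
  qed
  fix \<W> :: "'a set set" and s
  assume "(\<forall>W\<in>\<W>. openin X W \<and> s W \<in> carrier (sect ?R W)) \<and>
    (\<forall>W\<in>\<W>. \<forall>W'\<in>\<W>. res ?R W (W \<inter> W') (s W) = res ?R W' (W \<inter> W') (s W'))"
  then have s: "\<And>W. W \<in> \<W> \<Longrightarrow> openin X W" "\<And>W. W \<in> \<W> \<Longrightarrow> s W \<in> carrier (sect F (U \<inter> W))"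
    and c: "\<And>W W'. \<lbrakk>W \<in> \<W>; W' \<in> \<W>\<rbrakk> \<Longrightarrow>
      res F (U \<inter> W) (U \<inter> (W \<inter> W')) (s W) = res F (U \<inter> W') (U \<inter> (W \<inter> W')) (s W')"
    unfolding restrict_psh_def psh.simps by blast+
  \<comment> \<open>Reindexes the family by the intersections with \<open>U\<close>. Different
    members may have the same intersection; compatibility then forces their sections to be
    equal.\<close>
  define s' where "s' V = s (SOME W. W \<in> \<W> \<and> U \<inter> W = V)" for V
  have s': "s' (U \<inter> W) = s W" if W: "W \<in> \<W>" for W
  proof -
    define W' where "W' = (SOME W'. W' \<in> \<W> \<and> U \<inter> W' = U \<inter> W)"
    have "\<exists>W'. W' \<in> \<W> \<and> U \<inter> W' = U \<inter> W" using W by blast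
    from someI_ex[OF this] have W': "W' \<in> \<W>" "U \<inter> W' = U \<inter> W" by (simp_all add: W'_def)
    have "U \<inter> (W \<inter> W') = U \<inter> W" using W'(2) by blast
    then have "res F (U \<inter> W) (U \<inter> W) (s W) = res F (U \<inter> W) (U \<inter> W) (s W')"
      using c[OF W W'(1)] W'(2) by simp
    then show ?thesis
      using presheaf_res_self[OF P op[OF s(1)[OF W]]] s(2)[OF W] s(2)[OF W'(1)] W'(2)
      by (simp add: s'_def W'_def)
  qed
  have "\<exists>!t. t \<in> carrier (sect F (\<Union>((\<inter>) U ` \<W>))) \<and>
      (\<forall>V\<in>(\<inter>) U ` \<W>. res F (\<Union>((\<inter>) U ` \<W>)) V t = s' V)"
  proof (rule sheaf_unique_glue[OF F])
    show "openin X V \<and> s' V \<in> carrier (sect F V)" if "V \<in> (\<inter>) U ` \<W>" for V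
      using that s s' op by auto
    show "res F V (V \<inter> V') (s' V) = res F V' (V \<inter> V') (s' V')"
      if VV: "V \<in> (\<inter>) U ` \<W>" "V' \<in> (\<inter>) U ` \<W>" for V V'
    proof -
      obtain W W' where W: "W \<in> \<W>" "W' \<in> \<W>" "V = U \<inter> W" "V' = U \<inter> W'" using VV by blast
      have "V \<inter> V' = U \<inter> (W \<inter> W')" using W by blast
      then show ?thesis using c[OF W(1,2)] s'[OF W(1)] s'[OF W(2)] W(3,4) by simp
    qed
  qed
  moreover have "\<Union>((\<inter>) U ` \<W>) = U \<inter> \<Union>\<W>" by blast
  ultimately show "\<exists>!t. t \<in> carrier (sect ?R (\<Union>\<W>)) \<and> (\<forall>W\<in>\<W>. res ?R (\<Union>\<W>) W t = s W)"
    using s' by (simp add: restrict_psh_def)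
qed

section \<open>Extension by zero and injectivity\<close>

lemma injective_sheafD:
  fixes A B I :: "('x, ('x, 'b) univ) psh"
  assumes "injective_sheaf X I" "sheaf X A" "sheaf X B" "\<iota> \<in> psh_mono X A B" "f \<in> psh_hom X A I"
  shows "\<exists>g\<in>psh_hom X B I. \<forall>U. openin X U \<longrightarrow> (\<forall>a\<in>carrier (sect A U). g U (\<iota> U a) = f U a)"
  using assms unfolding injective_sheaf_def by metis

text \<open>\<open>sect A {}\<close> serves as the zero group: it is trivial when \<open>A\<close>
  is a sheaf and has the value type of \<open>A\<close>, so that extension by zero does not leave
  the sheaves on which injectivity is tested.\<close>

definition zero_extension :: "('x, 'b) psh \<Rightarrow> 'x set \<Rightarrow> ('x, 'b) psh" where
  "zero_extension A U =
     \<lparr>sect = (\<lambda>W. if W \<subseteq> U then sect A W else sect A {}),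
      res = (\<lambda>W W'. if W \<subseteq> U then res A W W' else (\<lambda>s. \<one>\<^bsub>sect A (if W' \<subseteq> U then W' else {})\<^esub>))\<rparr>"

definition nested_opens :: "'x topology \<Rightarrow> bool" where
  "nested_opens X \<longleftrightarrow> (\<forall>U W. openin X U \<and> openin X W \<longrightarrow> U \<subseteq> W \<or> W \<subseteq> U)"

context
  fixes X :: "'x topology" and U :: "'x set"
  assumes U: "openin X U"
begin

lemma openin_sub: "openin (subtopology X U) W \<longleftrightarrow> openin X W \<and> W \<subseteq> U"
  using U by (rule openin_open_subtopology)

lemma topspace_sub: "topspace (subtopology X U) = U"
  using openin_subset[OF U] by (simp add: topspace_subtopology Int_absorb1)

lemma presheaf_subtopology: "presheaf X F \<Longrightarrow> presheaf (subtopology X U) F"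
  by (simp add: presheaf_def openin_sub)

lemma sheaf_subtopology:
  assumes "sheaf X F"
  shows "sheaf (subtopology X U) F"
  unfolding sheaf_def
proof (intro conjI allI impI)
  show "presheaf (subtopology X U) F"
    using assms by (intro presheaf_subtopology sheaf_imp_presheaf)
  show "\<exists>!t. t \<in> carrier (sect F (\<Union>\<W>)) \<and> (\<forall>W\<in>\<W>. res F (\<Union>\<W>) W t = s W)"
    if "(\<forall>W\<in>\<W>. openin (subtopology X U) W \<and> s W \<in> carrier (sect F W)) \<and>
      (\<forall>W\<in>\<W>. \<forall>W'\<in>\<W>. res F W (W \<inter> W') (s W) = res F W' (W \<inter> W') (s W'))" for \<W> s
    by (rule sheaf_unique_glue[OF assms]) (use that openin_sub in blast)+
qed

lemma psh_hom_subtopology: "\<phi> \<in> psh_hom X F G \<Longrightarrow> \<phi> \<in> psh_hom (subtopology X U) F G"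
  by (simp add: psh_hom_def openin_sub)

lemma psh_mono_subtopology: "\<phi> \<in> psh_mono X F G \<Longrightarrow> \<phi> \<in> psh_mono (subtopology X U) F G"
  using psh_hom_subtopology by (auto simp: psh_mono_def openin_sub)

lemma sheaf_exact_at_subtopology:
  assumes "sheaf_exact_at X A \<phi> B \<psi> C"
  shows "sheaf_exact_at (subtopology X U) A \<phi> B \<psi> C"
proof -
  have "image_sections (subtopology X U) A \<phi> B W = image_sections X A \<phi> B W" if "W \<subseteq> U" for W
  proof -
    have "openin X W' \<and> W' \<subseteq> U \<and> x \<in> W' \<and> W' \<subseteq> W \<and> P \<longleftrightarrow> openin X W' \<and> x \<in> W' \<and> W' \<subseteq> W \<and> P"
      for W' x P using that by blast
    then show ?thesis unfolding image_sections_def openin_sub conj_assoc by simp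
  qed
  then show ?thesis using assms by (simp add: sheaf_exact_at_iff openin_sub)
qed

lemma restrict_psh_eq_on: "psh_eq_on (subtopology X U) (restrict_psh F U) F"
  by (auto simp: psh_eq_on_def restrict_psh_def openin_sub Int_absorb1)

lemma zero_extension_eq_on: "psh_eq_on (subtopology X U) (zero_extension A U) A"
  by (auto simp: psh_eq_on_def zero_extension_def openin_sub)

text \<open>
  In general extension by zero requires sheafification. It does not if the open sets are nested,
  since then every cover of a set not contained in \<open>U\<close> has a member that contains \<open>U\<close>.
\<close>

lemma sheaf_zero_extension:
  assumes nested: "nested_opens X" and A: "sheaf (subtopology X U) A"
  shows "sheaf X (zero_extension A U)"
  unfolding sheaf_def
proof (intro conjI allI impI)
  let ?Y = "subtopology X U" and ?E = "zero_extension A U"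
  have P: "presheaf ?Y A" using A by (rule sheaf_imp_presheaf)
  have op: "openin ?Y (if W \<subseteq> U then W else {})" if "openin X W" for W
    using that by (simp add: openin_sub)
  have sE: "sect ?E W = sect A (if W \<subseteq> U then W else {})" for W
    by (simp add: zero_extension_def)
  have triv: "s = \<one>\<^bsub>sect A {}\<^esub>" if "s \<in> carrier (sect A {})" for s
    using A that by (rule sheaf_empty)
  have one: "\<one>\<^bsub>sect A W\<^esub> \<in> carrier (sect A W)" if "openin ?Y W" for W
    using presheaf_group[OF P that] by (simp add: group.is_monoid)
  show "presheaf X ?E"
    unfolding presheaf_def
  proof (intro conjI allI impI ballI)
    show "comm_group (sect ?E W)" if "openin X W" for W
      unfolding sE by (rule presheaf_comm_group[OF P op[OF that]])
    show "res ?E W W' \<in> hom (sect ?E W) (sect ?E W')"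
      if W: "openin X W \<and> openin X W' \<and> W' \<subseteq> W" for W W'
    proof (cases "W \<subseteq> U")
      case True
      then show ?thesis
        using W presheaf_res_hom[OF P, of W W'] by (auto simp: zero_extension_def openin_sub)
    next
      case False
      interpret group "sect ?E W'" unfolding sE using presheaf_group[OF P op] W by blast
      have "res ?E W W' = (\<lambda>s. \<one>\<^bsub>sect ?E W'\<^esub>)"
        using False unfolding sE by (simp add: zero_extension_def)
      then show ?thesis by (simp add: hom_def)
    qed
    show "res ?E W W s = s" if "openin X W" "s \<in> carrier (sect ?E W)" for W s
      using that presheaf_res_self[OF P, of W] triv
      by (auto simp: zero_extension_def openin_sub split: if_splits)
    show "res ?E W' W'' (res ?E W W' s) = res ?E W W'' s"
      if "openin X W \<and> openin X W' \<and> openin X W'' \<and> W'' \<subseteq> W' \<and> W' \<subseteq> W" "s \<in> carrier (sect ?E W)"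
      for W W' W'' s
    proof (cases "W \<subseteq> U")
      case True
      then show ?thesis
        using that presheaf_res_res[OF P, of W W' W''] by (auto simp: zero_extension_def openin_sub)
    next
      case False
      then show ?thesis
        using that presheaf_res_one[OF P, of W' W''] by (auto simp: zero_extension_def openin_sub)
    qed
  qed
  fix \<W> :: "'x set set" and s
  assume "(\<forall>W\<in>\<W>. openin X W \<and> s W \<in> carrier (sect ?E W)) \<and>
    (\<forall>W\<in>\<W>. \<forall>W'\<in>\<W>. res ?E W (W \<inter> W') (s W) = res ?E W' (W \<inter> W') (s W'))"
  then have s: "\<And>W. W \<in> \<W> \<Longrightarrow> openin X W" "\<And>W. W \<in> \<W> \<Longrightarrow> s W \<in> carrier (sect ?E W)"
    and c: "\<And>W W'. \<lbrakk>W \<in> \<W>; W' \<in> \<W>\<rbrakk> \<Longrightarrow> res ?E W (W \<inter> W') (s W) = res ?E W' (W \<inter> W') (s W')"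
    by blast+
  show "\<exists>!t. t \<in> carrier (sect ?E (\<Union>\<W>)) \<and> (\<forall>W\<in>\<W>. res ?E (\<Union>\<W>) W t = s W)"
  proof (cases "\<Union>\<W> \<subseteq> U")
    case True
    then have sub: "W \<subseteq> U" if "W \<in> \<W>" for W using that by blast
    have "\<exists>!t. t \<in> carrier (sect A (\<Union>\<W>)) \<and> (\<forall>W\<in>\<W>. res A (\<Union>\<W>) W t = s W)"
    proof (rule sheaf_unique_glue[OF A])
      show "openin ?Y W \<and> s W \<in> carrier (sect A W)" if "W \<in> \<W>" for W
        using s[OF that] sub[OF that] by (simp add: openin_sub sE)
      show "res A W (W \<inter> W') (s W) = res A W' (W \<inter> W') (s W')" if "W \<in> \<W>" "W' \<in> \<W>" for W W'
        using c[OF that] sub[OF that(1)] sub[OF that(2)] by (simp add: zero_extension_def)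
    qed
    then show ?thesis using True by (simp add: zero_extension_def)
  next
    case False
    then obtain W0 where W0: "W0 \<in> \<W>" "\<not> W0 \<subseteq> U" by blast
    then have UW0: "U \<subseteq> W0" using nested U s(1) by (auto simp: nested_opens_def)
    \<comment> \<open>For \<open>W\<close> inside \<open>U\<close>, hence inside \<open>W0\<close>,
      compatibility identifies \<open>s W\<close> with the restriction of \<open>s W0\<close>, and
      every restriction out of a set not contained in \<open>U\<close> is the unit.\<close>
    have eq: "s W = \<one>\<^bsub>sect A (if W \<subseteq> U then W else {})\<^esub>" if W: "W \<in> \<W>" for W
    proof (cases "W \<subseteq> U")
      case True
      then have "W \<inter> W0 = W" using UW0 by blast
      then show ?thesis
        using c[OF W W0(1)] True W0(2) s[OF W] presheaf_res_self[OF P, of W]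
        by (simp add: zero_extension_def openin_sub)
    qed (use triv s(2)[OF W] in \<open>simp add: sE\<close>)
    show ?thesis
    proof (rule ex1I, intro conjI ballI)
      show "\<one>\<^bsub>sect A {}\<^esub> \<in> carrier (sect ?E (\<Union>\<W>))" using False one[of "{}"] by (simp add: sE)
      show "res ?E (\<Union>\<W>) W \<one>\<^bsub>sect A {}\<^esub> = s W" if "W \<in> \<W>" for W
        using False eq[OF that] by (simp add: zero_extension_def)
      show "t = \<one>\<^bsub>sect A {}\<^esub>"
        if "t \<in> carrier (sect ?E (\<Union>\<W>)) \<and> (\<forall>W\<in>\<W>. res ?E (\<Union>\<W>) W t = s W)" for t
        using that False triv by (simp add: sE)
    qed
  qed
qed

text \<open>One direction of the adjunction between extension by zero and restriction to
  \<open>U\<close>: off \<open>U\<close> the source is trivial, so the unit is the only possible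
  value.\<close>

lemma zero_extension_hom:
  assumes A: "sheaf (subtopology X U) A" and G: "presheaf X G"
    and \<phi>: "\<phi> \<in> psh_hom (subtopology X U) A G"
  shows "(\<lambda>W s. if W \<subseteq> U then \<phi> W s else \<one>\<^bsub>sect G W\<^esub>) \<in> psh_hom X (zero_extension A U) G"
proof (rule psh_homI)
  let ?Y = "subtopology X U"
  show "(\<lambda>s. if W \<subseteq> U then \<phi> W s else \<one>\<^bsub>sect G W\<^esub>) \<in> hom (sect (zero_extension A U) W) (sect G W)"
    if "openin X W" for W
  proof -
    interpret group "sect G W" using G that by (rule presheaf_group)
    show ?thesis using that psh_hom_hom[OF \<phi>, of W] by (auto simp: zero_extension_def hom_def openin_sub)
  qed
  fix W W' s assume W: "openin X W" "openin X W'" "W' \<subseteq> W" and s: "s \<in> carrier (sect (zero_extension A U) W)"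
  have "\<phi> W' \<one>\<^bsub>sect A W'\<^esub> = \<one>\<^bsub>sect G W'\<^esub>" if "W' \<subseteq> U"
    using psh_hom_one[OF \<phi> sheaf_imp_presheaf[OF A] presheaf_subtopology[OF G]] W(2) that
    by (simp add: openin_sub)
  then show "(if W' \<subseteq> U then \<phi> W' (res (zero_extension A U) W W' s) else \<one>\<^bsub>sect G W'\<^esub>) =
      res G W W' (if W \<subseteq> U then \<phi> W s else \<one>\<^bsub>sect G W\<^esub>)"
    using W s psh_hom_res[OF \<phi>, of W W'] presheaf_res_one[OF G W]
    by (auto simp: zero_extension_def openin_sub)
qed

lemma zero_extension_mono:
  assumes A: "sheaf (subtopology X U) A" and G: "presheaf X G"
    and \<phi>: "\<phi> \<in> psh_mono (subtopology X U) A G"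
  shows "(\<lambda>W s. if W \<subseteq> U then \<phi> W s else \<one>\<^bsub>sect G W\<^esub>) \<in> psh_mono X (zero_extension A U) G"
proof -
  have "inj_on (\<lambda>s. if W \<subseteq> U then \<phi> W s else \<one>\<^bsub>sect G W\<^esub>) (carrier (sect (zero_extension A U) W))"
    if "openin X W" for W
  proof (cases "W \<subseteq> U")
    case True
    then show ?thesis
      using that \<phi> by (simp add: zero_extension_def psh_mono_def openin_sub)
  next
    case False
    then show ?thesis
      using sheaf_empty[OF A] by (auto simp: zero_extension_def inj_on_def)
  qed
  then show ?thesis
    using zero_extension_hom[OF A G] \<phi> by (simp add: psh_mono_def)
qed

text \<open>
  With \<open>j\<close> the inclusion of \<open>U\<close>, extending the counit \<open>j\<^sub>! (I|\<^sub>U) \<rightarrow> I\<close> along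
  \<open>j\<^sub>! (I|\<^sub>U) \<rightarrow> j\<^sub>* (I|\<^sub>U)\<close> yields a section of the restriction map \<open>I(X) \<rightarrow> I(U)\<close>.
\<close>

lemma injective_sheaf_flasque:
  fixes I :: "('x, ('x, 'b) univ) psh"
  assumes nested: "nested_opens X" and I: "injective_sheaf X I" and s: "s \<in> carrier (sect I U)"
  obtains t where "t \<in> carrier (sect I (topspace X))" "res I (topspace X) U t = s"
proof -
  let ?Y = "subtopology X U" and ?R = "restrict_psh I U"
  have Is: "sheaf X I" using I by (rule injective_imp_sheaf)
  have Ip: "presheaf X I" using Is by (rule sheaf_imp_presheaf)
  have Rs: "sheaf X ?R" using Is U by (rule sheaf_restrict_psh)
  have Iy: "sheaf ?Y I" using Is by (rule sheaf_subtopology)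
  have idI: "(\<lambda>W s. s) \<in> psh_mono ?Y I I"
    by (simp add: psh_mono_def psh_hom_def hom_def)
  then have idR: "(\<lambda>W s. s) \<in> psh_mono ?Y I ?R"
    using psh_mono_cong[OF psh_eq_on_refl restrict_psh_eq_on, of I I] by simp
  let ?\<iota> = "\<lambda>W s. if W \<subseteq> U then s else \<one>\<^bsub>sect ?R W\<^esub>" and ?f = "\<lambda>W s. if W \<subseteq> U then s else \<one>\<^bsub>sect I W\<^esub>"
  have \<iota>: "?\<iota> \<in> psh_mono X (zero_extension I U) ?R"
    by (rule zero_extension_mono[OF Iy sheaf_imp_presheaf[OF Rs] idR])
  have f: "?f \<in> psh_hom X (zero_extension I U) I"
    using zero_extension_mono[OF Iy Ip idI] by (simp add: psh_mono_def)
  have "\<exists>g\<in>psh_hom X ?R I. \<forall>W. openin X W \<longrightarrow>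
      (\<forall>a\<in>carrier (sect (zero_extension I U) W). g W (?\<iota> W a) = ?f W a)"
    by (rule injective_sheafD[OF I sheaf_zero_extension[OF nested Iy] Rs \<iota> f])
  then obtain g where g: "g \<in> psh_hom X ?R I"
    "\<forall>W. openin X W \<longrightarrow> (\<forall>a\<in>carrier (sect (zero_extension I U) W). g W (?\<iota> W a) = ?f W a)" ..
  have UX: "U \<inter> topspace X = U" "U \<subseteq> topspace X" using openin_subset[OF U] by auto
  \<comment> \<open>A section over \<open>U\<close> is a global section of the direct image
    \<open>?R\<close>; \<open>g\<close> carries it to a global section of \<open>I\<close>, and over
    \<open>U\<close> itself \<open>g\<close> is the identity.\<close>
  have sR: "s \<in> carrier (sect ?R (topspace X))" using s UX by (simp add: restrict_psh_def)
  have "res I (topspace X) U (g (topspace X) s) = g U (res ?R (topspace X) U s)"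
    using psh_hom_res[OF g(1) openin_topspace U UX(2) sR] by simp
  also have "\<dots> = g U s" using presheaf_res_self[OF Ip U s] UX by (simp add: restrict_psh_def)
  also have "\<dots> = s" using g(2)[rule_format, OF U, of s] s by (simp add: zero_extension_def)
  finally show ?thesis using that psh_hom_closed[OF g(1) openin_topspace sR] by blast
qed

text \<open>Restriction to \<open>U\<close> is right adjoint to extension by zero, which preserves
  monomorphisms. An extension problem on \<open>U\<close> is extended by zero, solved on
  \<open>X\<close> and restricted back; the points keep their type, so \<open>univ\<close> is the
  same on both spaces.\<close>

lemma injective_sheaf_restrict:
  fixes I :: "('x, ('x, 'b) univ) psh"
  assumes nested: "nested_opens X" and I: "injective_sheaf X I"
  shows "injective_sheaf (subtopology X U) (restrict_psh I U)"
  unfolding injective_sheaf_def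
proof (intro conjI allI ballI impI)
  let ?Y = "subtopology X U"
  have Is: "sheaf X I" using I by (rule injective_imp_sheaf)
  show "sheaf ?Y (restrict_psh I U)"
    using sheaf_subtopology[OF sheaf_restrict_psh[OF Is U]] .
  fix A B :: "('x, ('x, 'b) univ) psh" and \<iota> f
  assume \<iota>: "\<iota> \<in> psh_mono ?Y A B" and f: "f \<in> psh_hom ?Y A (restrict_psh I U)"
    and "sheaf ?Y A \<and> sheaf ?Y B"
  then have A: "sheaf ?Y A" and B: "sheaf ?Y B" by auto
  let ?A = "zero_extension A U" and ?B = "zero_extension B U"
  have Bs: "sheaf X ?B" using nested B by (rule sheaf_zero_extension)
  have f': "f \<in> psh_hom ?Y A I"
    using f psh_hom_cong[OF psh_eq_on_refl restrict_psh_eq_on, of A I] by simp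
  have \<iota>': "\<iota> \<in> psh_mono ?Y A ?B"
    using \<iota> psh_mono_cong[OF psh_eq_on_refl zero_extension_eq_on, of A B] by simp
  have "\<exists>g\<in>psh_hom X ?B I. \<forall>W. openin X W \<longrightarrow>
      (\<forall>a\<in>carrier (sect ?A W). g W (if W \<subseteq> U then \<iota> W a else \<one>\<^bsub>sect ?B W\<^esub>) =
        (if W \<subseteq> U then f W a else \<one>\<^bsub>sect I W\<^esub>))"
    by (rule injective_sheafD[OF I sheaf_zero_extension[OF nested A] Bs
          zero_extension_mono[OF A sheaf_imp_presheaf[OF Bs] \<iota>']
          zero_extension_hom[OF A sheaf_imp_presheaf[OF Is] f']])
  then obtain g where g: "g \<in> psh_hom X ?B I"
    "\<forall>W. openin X W \<longrightarrow> (\<forall>a\<in>carrier (sect ?A W). g W (if W \<subseteq> U then \<iota> W a else \<one>\<^bsub>sect ?B W\<^esub>) =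
      (if W \<subseteq> U then f W a else \<one>\<^bsub>sect I W\<^esub>))" ..
  \<comment> \<open>On opens inside \<open>U\<close> the extensions by zero agree with
    \<open>A\<close> and \<open>B\<close>, so \<open>g\<close> already solves the problem on
    \<open>U\<close>.\<close>
  have "g \<in> psh_hom ?Y B (restrict_psh I U)"
    using psh_hom_subtopology[OF g(1)] psh_hom_cong[OF zero_extension_eq_on psh_eq_on_refl, of B I]
      psh_hom_cong[OF psh_eq_on_refl restrict_psh_eq_on, of B I] by simp
  moreover have "g W (\<iota> W a) = f W a" if "openin ?Y W" "a \<in> carrier (sect A W)" for W a
    using g(2)[rule_format, of W a] that by (simp add: openin_sub zero_extension_def)
  ultimately show "\<exists>g\<in>psh_hom ?Y B (restrict_psh I U).
      \<forall>W. openin ?Y W \<longrightarrow> (\<forall>a\<in>carrier (sect A W). g W (\<iota> W a) = f W a)"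
    by (intro bexI[of _ g]) simp_all
qed

lemma injective_resolution_restrict:
  assumes nested: "nested_opens X" and I: "injective_resolution X F \<epsilon> I d"
  shows "injective_resolution (subtopology X U) (restrict_psh F U) \<epsilon> (\<lambda>n. restrict_psh (I n) U) d"
  unfolding injective_resolution_def
proof (intro conjI allI)
  let ?Y = "subtopology X U"
  note r = restrict_psh_eq_on
  show "injective_sheaf ?Y (restrict_psh (I n) U)" for n
    by (rule injective_sheaf_restrict[OF nested resolution_injective[OF I]])
  show "\<epsilon> \<in> psh_mono ?Y (restrict_psh F U) (restrict_psh (I 0) U)"
    using psh_mono_subtopology[OF resolution_aug_mono[OF I]] psh_mono_cong[OF r r, of F "I 0"] by simp
  show "d n \<in> psh_hom ?Y (restrict_psh (I n) U) (restrict_psh (I (Suc n)) U)" for n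
    using psh_hom_subtopology[OF resolution_d_hom[OF I]] psh_hom_cong[OF r r, of "I n" "I (Suc n)"] by simp
  show "sheaf_exact_at ?Y (restrict_psh F U) \<epsilon> (restrict_psh (I 0) U) (d 0) (restrict_psh (I 1) U)"
    using sheaf_exact_at_subtopology[OF resolution_exact_0[OF I]] sheaf_exact_at_cong[OF r r r, of F \<epsilon> "I 0" "d 0" "I (Suc 0)"] by simp
  show "sheaf_exact_at ?Y (restrict_psh (I n) U) (d n) (restrict_psh (I (Suc n)) U) (d (Suc n))
      (restrict_psh (I (Suc (Suc n))) U)" for n
    using sheaf_exact_at_subtopology[OF resolution_exact[OF I]] sheaf_exact_at_cong[OF r r r, of "I n" "d n" "I (Suc n)" "d (Suc n)" "I (Suc (Suc n))"] by simp
qed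

end

section \<open>Local cohomology on spaces with nested open sets\<close>

text \<open>The empty set occurs as \<open>U\<close> when \<open>Z\<close> is all of
  \<open>X\<close>; a sheaf has only the trivial section over it.\<close>

definition local_open :: "'x topology \<Rightarrow> 'x set \<Rightarrow> bool" where
  "local_open X U \<longleftrightarrow> U = {} \<or> (\<exists>x\<in>U. \<forall>W. openin X W \<and> x \<in> W \<and> W \<subseteq> U \<longrightarrow> W = U)"

text \<open>A finite nonempty chain contains its own union, so a finite cover by proper open subsets
  of \<open>U\<close> would have \<open>U\<close> as a member.\<close>

lemma local_open_if_compactin:
  assumes nested: "nested_opens X" and cpt: "compactin X U"
  shows "local_open X U"
proof (rule ccontr)
  assume "\<not> local_open X U"
  then have ne: "U \<noteq> {}" and "\<forall>x\<in>U. \<exists>W. openin X W \<and> x \<in> W \<and> W \<subset> U"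
    unfolding local_open_def by blast+
  then have "\<forall>W\<in>{W. openin X W \<and> W \<subset> U}. openin X W" "U \<subseteq> \<Union>{W. openin X W \<and> W \<subset> U}"
    by blast+
  then obtain \<F> where \<F>: "finite \<F>" "\<F> \<subseteq> {W. openin X W \<and> W \<subset> U}" "U \<subseteq> \<Union>\<F>"
    using cpt unfolding compactin_def by meson
  have "\<F> \<noteq> {}" using \<F>(3) ne by auto
  moreover have "subset.chain {W. openin X W \<and> W \<subset> U} \<F>"
    using \<F>(2) nested unfolding subset_chain_def nested_opens_def by blast
  ultimately have "\<Union>\<F> \<in> \<F>"
    using \<F>(1) Union_in_chain by blast
  then show False using \<F>(2,3) by blast
qed

text \<open>At the distinguished point the only neighbourhood inside \<open>U\<close> is
  \<open>U\<close>, so a local preimage there is a preimage over \<open>U\<close>.\<close>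

lemma sheaf_exact_at_local_open:
  assumes ex: "sheaf_exact_at X A \<phi> B \<psi> C" and A: "presheaf X A" and B: "sheaf X B"
    and \<phi>: "\<phi> \<in> psh_hom X A B" and U: "openin X U" "local_open X U"
    and t: "t \<in> carrier (sect B U)" "\<psi> U t = \<one>\<^bsub>sect C U\<^esub>"
  obtains a where "a \<in> carrier (sect A U)" "\<phi> U a = t"
proof (cases "U = {}")
  case True
  interpret group "sect A U" using A U(1) by (rule presheaf_group)
  have "\<phi> U \<one>\<^bsub>sect A U\<^esub> = t"
    using psh_hom_one[OF \<phi> A sheaf_imp_presheaf[OF B] U(1)] sheaf_empty[OF B] t(1) True by simp
  then show ?thesis using that[of "\<one>\<^bsub>sect A U\<^esub>"] by simp
next
  case False
  then obtain x where x: "x \<in> U" "\<And>W. \<lbrakk>openin X W; x \<in> W; W \<subseteq> U\<rbrakk> \<Longrightarrow> W = U"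
    using U(2) unfolding local_open_def by blast
  have "t \<in> image_sections X A \<phi> B U" using ex U(1) t by (simp add: sheaf_exact_at_iff)
  from image_sectionsE[OF this x(1)] obtain W a where "openin X W" "x \<in> W" "W \<subseteq> U"
    "a \<in> carrier (sect A W)" "res B U W t = \<phi> W a" .
  with x(2) have "a \<in> carrier (sect A U)" "res B U U t = \<phi> U a" by blast+
  then show ?thesis
    using that presheaf_res_self[OF sheaf_imp_presheaf[OF B] U(1) t(1)] by simp
qed

text \<open>Left exactness of sections over any open set: local preimages under \<epsilon> are
  unique, hence compatible, and glue in \<open>F\<close>.\<close>

lemma resolution_sections_exact_0:
  assumes F: "sheaf X F" and I: "injective_resolution X F \<epsilon> I d" and U: "openin X U"
    and t: "t \<in> carrier (sect (I 0) U)" "d 0 U t = \<one>\<^bsub>sect (I (Suc 0)) U\<^esub>"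
  obtains a where "a \<in> carrier (sect F U)" "\<epsilon> U a = t"
proof -
  have P: "presheaf X F" using F by (rule sheaf_imp_presheaf)
  note Ip = resolution_presheaf[OF I] and \<epsilon> = resolution_aug_hom[OF I]
  have im: "t \<in> image_sections X F \<epsilon> (I 0) U"
    using resolution_exact_0[OF I] U t by (simp add: sheaf_exact_at_iff)
  have id: "(\<lambda>U s. s) \<in> psh_hom X F F" by (simp add: psh_hom_def hom_def)
  have ker: "a = \<one>\<^bsub>sect F W\<^esub>"
    if W: "openin X W" and a: "a \<in> carrier (sect F W)" "\<epsilon> W a = \<one>\<^bsub>sect (I 0) W\<^esub>" for W a
  proof -
    interpret group "sect F W" using P W by (rule presheaf_group)
    show ?thesis
      using resolution_aug_mono[OF I] psh_hom_one[OF \<epsilon> P Ip W] W a one_closed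
      unfolding psh_mono_def inj_on_def by force
  qed
  \<comment> \<open>Descent with the identity of \<open>F\<close> as \<psi>, for which the kernel
    condition is the injectivity of \<epsilon>.\<close>
  obtain c where c: "c \<in> carrier (sect F U)"
    "\<And>W a. \<lbrakk>openin X W; W \<subseteq> U; a \<in> carrier (sect F W); \<epsilon> W a = res (I 0) U W t\<rbrakk>
      \<Longrightarrow> res F U W c = a"
    using descend_section[OF P Ip \<epsilon> F id ker U im] by metis
  have "\<epsilon> U c = t"
  proof (rule sheaf_local_eq[OF resolution_sheaf[OF I] U psh_hom_closed[OF \<epsilon> U c(1)] t(1)])
    fix x assume "x \<in> U"
    from image_sectionsE[OF im this] obtain W a where W: "openin X W" "x \<in> W" "W \<subseteq> U"
      and a: "a \<in> carrier (sect F W)" "res (I 0) U W t = \<epsilon> W a" .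
    have "res (I 0) U W (\<epsilon> U c) = res (I 0) U W t"
      using psh_hom_res[OF \<epsilon> U W(1,3) c(1)] c(2)[OF W(1,3) a(1)] a(2) by simp
    then show "\<exists>W. openin X W \<and> x \<in> W \<and> W \<subseteq> U \<and> res (I 0) U W (\<epsilon> U c) = res (I 0) U W t"
      using W by blast
  qed
  then show ?thesis using that c(1) by blast
qed

context
  fixes X :: "'x topology" and Z U :: "'x set" and F :: "('x, 'b) psh" and \<epsilon> I d
  assumes nested: "nested_opens X" and top: "local_open X (topspace X)"
    and U: "openin X U" and Z: "topspace X - Z = U"
    and F: "sheaf X F" and I: "injective_resolution X F \<epsilon> I d"
begin

private abbreviation (input) "S \<equiv> topspace X"

private lemmas Is = resolution_sheaf[OF I] and Ip = resolution_presheaf[OF I] and dh = resolution_d_hom[OF I]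

private lemmas US = openin_topspace[of X] U openin_subset[OF U]

lemma supported_sections_I:
  "supported_sections X Z (I n) = (sect (I n) S)\<lparr>carrier := kernel (sect (I n) S) (sect (I n) U) (res (I n) S U)\<rparr>"
  by (simp add: supported_sections_def Let_def Z)

lemma comm_group_supported_sections: "comm_group (supported_sections X Z (I n))"
  unfolding supported_sections_I
  by (rule comm_group_kernel[OF presheaf_comm_group[OF Ip US(1)] presheaf_comm_group[OF Ip US(2)]
        presheaf_res_hom[OF Ip US]])

lemma d_supported_sections:
  "d n S \<in> hom (supported_sections X Z (I n)) (supported_sections X Z (I (Suc n)))"
proof -
  have "res (I (Suc n)) S U (d n S s) = \<one>\<^bsub>sect (I (Suc n)) U\<^esub>"
    if "s \<in> carrier (sect (I n) S)" "res (I n) S U s = \<one>\<^bsub>sect (I n) U\<^esub>" for s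
    using psh_hom_res[OF dh US that(1)] that(2) psh_hom_one[OF dh Ip Ip US(2)] by simp
  then show ?thesis
    using psh_hom_closed[OF dh US(1)] psh_hom_mult[OF dh US(1)]
    by (simp add: supported_sections_I hom_def kernel_def)
qed

lemma subgroup_supported_boundaries:
  "subgroup (boundaries (\<lambda>n. supported_sections X Z (I n)) (\<lambda>n. d n S) i)
    ((supported_sections X Z (I i))\<lparr>carrier :=
      kernel (supported_sections X Z (I i)) (supported_sections X Z (I (Suc i))) (d i S)\<rparr>)"
proof (rule subgroup_boundaries[of "\<lambda>n. supported_sections X Z (I n)" "\<lambda>n. d n S"])
  show "d (Suc m) S (d m S x) = \<one>\<^bsub>supported_sections X Z (I (Suc (Suc m)))\<^esub>"
    if "x \<in> carrier (supported_sections X Z (I m))" for m x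
    using that resolution_dd[OF I US(1)] by (simp add: supported_sections_I kernel_def)
qed (rule comm_group_supported_sections d_supported_sections)+

text \<open>
  Both sides are quotients of \<open>{t \<in> I n (X). d t|\<^sub>U = 1}\<close>: map \<open>t\<close> to \<open>d t\<close>, which is onto the cocycles
  since sections over \<open>X\<close> are exact, and to \<open>t|\<^sub>U\<close>, which is onto since \<open>I n\<close> is flasque.
\<close>

lemma local_cohomology_Suc_iso:
  fixes A :: "('x, 'c) psh"
  assumes A: "presheaf X A" and \<phi>: "\<phi> \<in> psh_hom X A (I n)"
    and ex: "sheaf_exact_at X A \<phi> (I n) (d n) (I (Suc n))"
  shows "local_cohomology X Z I d (Suc n) \<cong>
    (sect (I n) U)\<lparr>carrier := kernel (sect (I n) U) (sect (I (Suc n)) U) (d n U)\<rparr> Mod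
      (\<lambda>a. \<phi> U (res A S U a)) ` carrier (sect A S)"
proof -
  let ?L = "\<lambda>n. supported_sections X Z (I n)" and ?d = "\<lambda>n. d n S"
  let ?H = "(sect (I n) U)\<lparr>carrier := kernel (sect (I n) U) (sect (I (Suc n)) U) (d n U)\<rparr>"
  let ?G = "(?L (Suc n))\<lparr>carrier := kernel (?L (Suc n)) (?L (Suc (Suc n))) (d (Suc n) S)\<rparr>"
  let ?k = "\<lambda>t. d n U (res (I n) S U t)"
  let ?K = "(sect (I n) S)\<lparr>carrier := kernel (sect (I n) S) (sect (I (Suc n)) U) ?k\<rparr>"
  let ?M = "(\<lambda>a. \<phi> U (res A S U a)) ` carrier (sect A S)"
  note rc = presheaf_res_closed[OF Ip US] and rm = presheaf_res_mult[OF Ip US]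
  note dX = psh_hom_closed[OF dh US(1)] and dU = psh_hom_closed[OF dh US(2)]
  note \<phi>X = psh_hom_closed[OF \<phi> US(1)]
  interpret IS: comm_group "sect (I n) S" using Ip US(1) by (rule presheaf_comm_group)
  interpret IU: comm_group "sect (I n) U" using Ip US(2) by (rule presheaf_comm_group)
  interpret IS': comm_group "sect (I (Suc n)) S" using Ip US(1) by (rule presheaf_comm_group)
  have khom: "?k \<in> hom (sect (I n) S) (sect (I (Suc n)) U)"
    using hom_compose[OF presheaf_res_hom[OF Ip US] psh_hom_hom[OF dh US(2)]] by (simp add: comp_def)
  have zero: "d n W (\<phi> W a) = \<one>\<^bsub>sect (I (Suc n)) W\<^esub>" if "openin X W" "a \<in> carrier (sect A W)" for W a
    using sheaf_exact_at_zero[OF ex A Ip \<phi> that] .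
  have H: "comm_group ?H"
    by (rule comm_group_kernel[OF presheaf_comm_group[OF Ip US(2)] presheaf_comm_group[OF Ip US(2)]
          psh_hom_hom[OF dh US(2)]])
  show ?thesis
    unfolding local_cohomology_def cohomology_def
  proof (rule Mod_iso_zigzag[where K = ?K and p = "d n S" and q = "res (I n) S U"])
    show "comm_group ?G"
      by (rule comm_group_kernel[OF comm_group_supported_sections comm_group_supported_sections
            d_supported_sections])
    show "comm_group ?H" by fact
    have "comm_group ?K"
      by (rule comm_group_kernel[OF presheaf_comm_group[OF Ip US(1)] presheaf_comm_group[OF Ip US(2)] khom])
    then show "group ?K" by (simp add: comm_group_def)
    show "subgroup (boundaries ?L ?d (Suc n)) ?G" by (rule subgroup_supported_boundaries)
    show "subgroup ?M ?H"
    proof -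
      have "(\<lambda>a. \<phi> U (res A S U a)) \<in> hom (sect A S) ?H"
        using presheaf_res_closed[OF A US] presheaf_res_mult[OF A US] psh_hom_closed[OF \<phi> US(2)]
          psh_hom_mult[OF \<phi> US(2)] zero[OF US(2)] by (simp add: hom_def kernel_def)
      then show ?thesis
        using group_hom.img_is_subgroup[OF group_homI[OF presheaf_comm_group[OF A US(1)] H]] by blast
    qed
    show "d n S \<in> hom ?K ?G"
      using dX psh_hom_mult[OF dh US(1)] psh_hom_res[OF dh US] resolution_dd[OF I US(1)]
      by (auto simp: hom_def supported_sections_I kernel_def)
    show "res (I n) S U \<in> hom ?K ?H"
      using rc rm by (simp add: hom_def kernel_def)
    show "\<exists>k\<in>carrier ?K. \<exists>m\<in>boundaries ?L ?d (Suc n). d n S k = m \<otimes>\<^bsub>?G\<^esub> g"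
      if "g \<in> carrier ?G" for g
    proof -
      have g: "g \<in> carrier (sect (I (Suc n)) S)" "res (I (Suc n)) S U g = \<one>\<^bsub>sect (I (Suc n)) U\<^esub>"
        "d (Suc n) S g = \<one>\<^bsub>sect (I (Suc (Suc n))) S\<^esub>"
        using that by (auto simp: supported_sections_I kernel_def)
      \<comment> \<open>A cocycle over \<open>X\<close> is a boundary of \<open>I n\<close> over
        \<open>X\<close>, though perhaps not of a section supported in \<open>Z\<close>; that
        difference is what local cohomology measures.\<close>
      obtain t where t: "t \<in> carrier (sect (I n) S)" "d n S t = g"
        using sheaf_exact_at_local_open[OF resolution_exact[OF I] Ip Is dh US(1) top, OF g(1,3)] .
      have "\<one>\<^bsub>sect (I n) S\<^esub> \<in> carrier (?L n)"
        using presheaf_res_one[OF Ip US] by (simp add: supported_sections_I kernel_def)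
      then have "\<one>\<^bsub>sect (I (Suc n)) S\<^esub> \<in> boundaries ?L ?d (Suc n)"
        using psh_hom_one[OF dh Ip Ip US(1)] unfolding boundaries_def by (simp add: rev_image_eqI)
      moreover have "t \<in> carrier ?K"
        using t g(2) psh_hom_res[OF dh US t(1)] by (simp add: kernel_def)
      ultimately show ?thesis
        using t g(1) by (intro bexI[of _ t] bexI[of _ "\<one>\<^bsub>sect (I (Suc n)) S\<^esub>"]) (simp_all add: supported_sections_I)
    qed
    show "\<exists>k\<in>carrier ?K. \<exists>m\<in>?M. res (I n) S U k = m \<otimes>\<^bsub>?H\<^esub> h" if "h \<in> carrier ?H" for h
    proof -
      have h: "h \<in> carrier (sect (I n) U)" "d n U h = \<one>\<^bsub>sect (I (Suc n)) U\<^esub>"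
        using that by (auto simp: kernel_def)
      obtain t where t: "t \<in> carrier (sect (I n) S)" "res (I n) S U t = h"
        using injective_sheaf_flasque[OF U nested resolution_injective[OF I] h(1)] .
      have "\<one>\<^bsub>sect A S\<^esub> \<in> carrier (sect A S)"
        using presheaf_group[OF A US(1)] by (simp add: group.is_monoid)
      then have "\<one>\<^bsub>sect (I n) U\<^esub> \<in> ?M"
        using presheaf_res_one[OF A US] psh_hom_one[OF \<phi> A Ip US(2)] by (simp add: rev_image_eqI)
      then show ?thesis
        using t h by (intro bexI[of _ t] bexI[of _ "\<one>\<^bsub>sect (I n) U\<^esub>"]) (simp_all add: kernel_def)
    qed
    show "d n S k \<in> boundaries ?L ?d (Suc n) \<longleftrightarrow> res (I n) S U k \<in> ?M" if "k \<in> carrier ?K" for k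
    proof
      have k: "k \<in> carrier (sect (I n) S)" using that by (simp add: kernel_def)
      show "res (I n) S U k \<in> ?M" if "d n S k \<in> boundaries ?L ?d (Suc n)"
      proof -
        from that obtain c where c: "c \<in> carrier (sect (I n) S)" "res (I n) S U c = \<one>\<^bsub>sect (I n) U\<^esub>"
          "d n S k = d n S c"
          by (auto simp: boundaries_def supported_sections_I kernel_def)
        \<comment> \<open>\<open>k\<close> and \<open>c\<close> have the same differential, so their
          quotient is a cocycle over \<open>X\<close> and comes from \<open>A\<close>. Restriction
          to \<open>U\<close> then removes \<open>c\<close>.\<close>
        have "d n S (k \<otimes>\<^bsub>sect (I n) S\<^esub> inv\<^bsub>sect (I n) S\<^esub> c) = \<one>\<^bsub>sect (I (Suc n)) S\<^esub>"
          using k c dX by (simp add: psh_hom_mult[OF dh US(1)] psh_hom_inv[OF dh Ip Ip US(1)])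
        moreover have "k \<otimes>\<^bsub>sect (I n) S\<^esub> inv\<^bsub>sect (I n) S\<^esub> c \<in> carrier (sect (I n) S)"
          using k c(1) by simp
        ultimately obtain a where a: "a \<in> carrier (sect A S)"
          "\<phi> S a = k \<otimes>\<^bsub>sect (I n) S\<^esub> inv\<^bsub>sect (I n) S\<^esub> c"
          using sheaf_exact_at_local_open[OF ex A Is \<phi> US(1) top] by metis
        have "res (I n) S U k = \<phi> U (res A S U a)"
          using psh_hom_res[OF \<phi> US a(1)] a(2) k c rc by (simp add: rm presheaf_res_inv[OF Ip US])
        then show ?thesis using a(1) by blast
      qed
      show "d n S k \<in> boundaries ?L ?d (Suc n)" if "res (I n) S U k \<in> ?M"
      proof -
        from that obtain a where a: "a \<in> carrier (sect A S)" "res (I n) S U k = \<phi> U (res A S U a)"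
          by blast
        \<comment> \<open>Dividing by the global section \<phi>\<open>S a\<close> does not change
          the differential and makes the restriction to \<open>U\<close> trivial.\<close>
        let ?c = "k \<otimes>\<^bsub>sect (I n) S\<^esub> inv\<^bsub>sect (I n) S\<^esub> \<phi> S a"
        have "res (I n) S U ?c = \<one>\<^bsub>sect (I n) U\<^esub>"
          using psh_hom_res[OF \<phi> US a(1)] a(2) k \<phi>X[OF a(1)] rc[OF \<phi>X[OF a(1)]]
          by (simp add: rm presheaf_res_inv[OF Ip US])
        then have "?c \<in> carrier (?L n)"
          using k \<phi>X[OF a(1)] by (simp add: supported_sections_I kernel_def)
        moreover have "d n S ?c = d n S k"
          using k \<phi>X[OF a(1)] dX[OF k] zero[OF US(1) a(1)]
          by (simp add: psh_hom_mult[OF dh US(1)] psh_hom_inv[OF dh Ip Ip US(1)])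
        ultimately have "d n S k \<in> d n S ` carrier (?L n)" by (metis imageI)
        then show ?thesis by (simp add: boundaries_def)
      qed
    qed
  qed
qed

text \<open>With \<open>A\<close> = \<open>F\<close>, \<open>local_cohomology_Suc_iso\<close> gives
  the kernel of \<open>d 0\<close> over \<open>U\<close> modulo the image of the global sections of
  \<open>F\<close>; left exactness identifies this kernel with the sections of \<open>F\<close> over
  \<open>U\<close>.\<close>

lemma local_cohomology_1_iso:
  "local_cohomology X Z I d (Suc 0) \<cong> sect F U Mod (res F S U ` carrier (sect F S))"
proof -
  have P: "presheaf X F" using F by (rule sheaf_imp_presheaf)
  note \<epsilon> = resolution_aug_hom[OF I]
  let ?H = "(sect (I 0) U)\<lparr>carrier := kernel (sect (I 0) U) (sect (I (Suc 0)) U) (d 0 U)\<rparr>"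
  let ?M = "(\<lambda>a. \<epsilon> U (res F S U a)) ` carrier (sect F S)"
  interpret FU: comm_group "sect F U" using P US(2) by (rule presheaf_comm_group)
  interpret IU: comm_group "sect (I 0) U" using Ip US(2) by (rule presheaf_comm_group)
  have H: "comm_group ?H"
    by (rule comm_group_kernel[OF presheaf_comm_group[OF Ip US(2)] presheaf_comm_group[OF Ip US(2)]
          psh_hom_hom[OF dh US(2)]])
  have \<epsilon>H: "\<epsilon> U \<in> hom (sect F U) ?H"
    using psh_hom_closed[OF \<epsilon> US(2)] psh_hom_mult[OF \<epsilon> US(2)] resolution_d_aug[OF I P US(2)]
    by (simp add: hom_def kernel_def)
  have rF: "res F S U \<in> hom (sect F S) (sect F U)" by (rule presheaf_res_hom[OF P US])
  have N: "subgroup (res F S U ` carrier (sect F S)) (sect F U)"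
    by (rule group_hom.img_is_subgroup[OF group_homI[OF presheaf_comm_group[OF P US(1)]
            FU.comm_group_axioms rF]])
  have M: "subgroup ?M ?H"
    using group_hom.img_is_subgroup[OF group_homI[OF presheaf_comm_group[OF P US(1)] H
          hom_compose[OF rF \<epsilon>H]]] by (simp add: comp_def)
  have "?H Mod ?M \<cong> sect F U Mod (res F S U ` carrier (sect F S))"
  proof (rule Mod_iso_zigzag[where K = "sect F U" and p = "\<epsilon> U" and q = "\<lambda>s. s"])
    show "(\<lambda>s. s) \<in> hom (sect F U) (sect F U)" by (simp add: hom_def)
    show "\<exists>k\<in>carrier (sect F U). \<exists>m\<in>?M. \<epsilon> U k = m \<otimes>\<^bsub>?H\<^esub> h" if "h \<in> carrier ?H" for h
    proof -
      have h: "h \<in> carrier (sect (I 0) U)" "d 0 U h = \<one>\<^bsub>sect (I (Suc 0)) U\<^esub>"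
        using that by (auto simp: kernel_def)
      then obtain a where "a \<in> carrier (sect F U)" "\<epsilon> U a = h"
        using resolution_sections_exact_0[OF F I US(2)] by blast
      then show ?thesis
        using h(1) subgroup.one_closed[OF M] by (intro bexI[of _ a] bexI[of _ "\<one>\<^bsub>sect (I 0) U\<^esub>"]) simp_all
    qed
    show "\<exists>k\<in>carrier (sect F U). \<exists>m\<in>res F S U ` carrier (sect F S). k = m \<otimes>\<^bsub>sect F U\<^esub> h"
      if "h \<in> carrier (sect F U)" for h
      using that subgroup.one_closed[OF N] by (intro bexI[of _ h] bexI[of _ "\<one>\<^bsub>sect F U\<^esub>"]) simp_all
    show "\<epsilon> U k \<in> ?M \<longleftrightarrow> k \<in> res F S U ` carrier (sect F S)" if "k \<in> carrier (sect F U)" for k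
    proof -
      have "inj_on (\<epsilon> U) (carrier (sect F U))"
        using resolution_aug_mono[OF I] US(2) by (simp add: psh_mono_def)
      then show ?thesis
        using that presheaf_res_closed[OF P US] unfolding inj_on_def by blast
    qed
  qed (fact H N M \<epsilon>H FU.comm_group_axioms FU.is_group)+
  then show ?thesis
    using local_cohomology_Suc_iso[OF P \<epsilon> resolution_exact_0[OF I]] iso_trans by blast
qed

lemma sheaf_cohomology_restrict_psh:
  "sheaf_cohomology (subtopology X U) (\<lambda>n. restrict_psh (I n) U) d i =
    cohomology (\<lambda>n. sect (I n) U) (\<lambda>n. d n U) i"
  unfolding sheaf_cohomology_def topspace_sub[OF U] by (simp add: restrict_psh_def)

text \<open>With \<open>A\<close> = \<open>I n\<close>, the subgroup divided out consists of the
  differentials of those sections over \<open>U\<close> that extend to \<open>X\<close>. As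
  \<open>I n\<close> is flasque, these are all boundaries over \<open>U\<close>.\<close>

lemma local_cohomology_Suc_Suc_iso_restrict:
  "local_cohomology X Z I d (Suc (Suc n)) \<cong>
    sheaf_cohomology (subtopology X U) (\<lambda>n. restrict_psh (I n) U) d (Suc n)"
proof -
  have "(\<lambda>a. d n U (res (I n) S U a)) ` carrier (sect (I n) S) = d n U ` carrier (sect (I n) U)"
  proof
    show "(\<lambda>a. d n U (res (I n) S U a)) ` carrier (sect (I n) S) \<subseteq> d n U ` carrier (sect (I n) U)"
      using presheaf_res_closed[OF Ip US] by blast
    show "d n U ` carrier (sect (I n) U) \<subseteq> (\<lambda>a. d n U (res (I n) S U a)) ` carrier (sect (I n) S)"
    proof
      fix y assume "y \<in> d n U ` carrier (sect (I n) U)"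
      then obtain s where s: "s \<in> carrier (sect (I n) U)" "y = d n U s" by blast
      obtain t where "t \<in> carrier (sect (I n) S)" "res (I n) S U t = s"
        using injective_sheaf_flasque[OF U nested resolution_injective[OF I] s(1)] .
      then show "y \<in> (\<lambda>a. d n U (res (I n) S U a)) ` carrier (sect (I n) S)" using s(2) by blast
    qed
  qed
  then show ?thesis
    using local_cohomology_Suc_iso[OF Ip dh resolution_exact[OF I], of n]
    by (simp add: sheaf_cohomology_restrict_psh cohomology_def boundaries_def)
qed

text \<open>The restricted resolution is itself injective, so the comparison theorem on
  \<open>U\<close> replaces it by any other one.\<close>

lemma local_cohomology_Suc_Suc_iso:
  assumes "injective_resolution (subtopology X U) (restrict_psh F U) \<eta> J e"
  shows "local_cohomology X Z I d (Suc (Suc n)) \<cong> sheaf_cohomology (subtopology X U) J e (Suc n)"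
proof -
  have "presheaf (subtopology X U) (restrict_psh F U)"
    using presheaf_subtopology[OF U sheaf_imp_presheaf[OF sheaf_restrict_psh[OF F U]]] .
  from sheaf_cohomology_iso[OF this injective_resolution_restrict[OF U nested I] assms]
  show ?thesis using local_cohomology_Suc_Suc_iso_restrict iso_trans by blast
qed

text \<open>Sections over \<open>U\<close> preserve the exactness of the resolution in positive
  degrees, so the cohomology of the restricted resolution vanishes there.\<close>

lemma local_cohomology_vanishes:
  assumes "local_open X U"
  shows "trivial_group (local_cohomology X Z I d (Suc (Suc n)))"
proof -
  let ?L = "\<lambda>n. supported_sections X Z (I n)"
  let ?H = "(sect (I (Suc n)) U)\<lparr>carrier := kernel (sect (I (Suc n)) U) (sect (I (Suc (Suc n))) U) (d (Suc n) U)\<rparr>"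
  have H: "comm_group ?H"
    by (rule comm_group_kernel[OF presheaf_comm_group[OF Ip US(2)] presheaf_comm_group[OF Ip US(2)]
          psh_hom_hom[OF dh US(2)]])
  have "d n U ` carrier (sect (I n) U) = carrier ?H"
  proof
    show "d n U ` carrier (sect (I n) U) \<subseteq> carrier ?H"
      using psh_hom_closed[OF dh US(2)] resolution_dd[OF I US(2)] by (auto simp: kernel_def)
    show "carrier ?H \<subseteq> d n U ` carrier (sect (I n) U)"
    proof
      fix h assume "h \<in> carrier ?H"
      then have h: "h \<in> carrier (sect (I (Suc n)) U)" "d (Suc n) U h = \<one>\<^bsub>sect (I (Suc (Suc n))) U\<^esub>"
        by (auto simp: kernel_def)
      obtain t where "t \<in> carrier (sect (I n) U)" "d n U t = h"
        using sheaf_exact_at_local_open[OF resolution_exact[OF I] Ip Is dh US(2) assms, OF h] .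
      then show "h \<in> d n U ` carrier (sect (I n) U)" by blast
    qed
  qed
  then have "trivial_group (?H Mod (d n U ` carrier (sect (I n) U)))"
    using H by (intro trivial_group_Mod_carrier) (simp_all add: comm_group_def)
  then have triv: "trivial_group (sheaf_cohomology (subtopology X U) (\<lambda>n. restrict_psh (I n) U) d (Suc n))"
    by (simp add: sheaf_cohomology_restrict_psh cohomology_def boundaries_def)
  let ?G = "(?L (Suc (Suc n)))\<lparr>carrier := kernel (?L (Suc (Suc n))) (?L (Suc (Suc (Suc n)))) (d (Suc (Suc n)) S)\<rparr>"
  have G: "comm_group ?G"
    by (rule comm_group_kernel[OF comm_group_supported_sections comm_group_supported_sections
          d_supported_sections])
  have "group (local_cohomology X Z I d (Suc (Suc n)))"
    unfolding local_cohomology_def cohomology_def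
    by (intro normal.factorgroup_is_group comm_group.subgroup_imp_normal G
        subgroup_supported_boundaries)
  then show ?thesis
    using isomorphic_group_triviality[OF local_cohomology_Suc_Suc_iso_restrict] triv
    by (simp add: trivial_group_def)
qed

end

section \<open>The spectrum of a valuation ring\<close>

lemma primeideal_subset_carrier: "primeideal P R \<Longrightarrow> P \<subseteq> carrier R"
  using additive_subgroup.a_subset[of P R] ideal.axioms(1) primeideal.axioms(1) by blast

text \<open>Of an element of \<open>P\<close> outside \<open>Q\<close> and one of \<open>Q\<close>
  outside \<open>P\<close>, one divides the other, and the multiple would lie in both
  ideals.\<close>

lemma valuation_ring_primes_nested:
  assumes V: "valuation_ring V" and P: "P \<in> spectrum V" and Q: "Q \<in> spectrum V"
  shows "P \<subseteq> Q \<or> Q \<subseteq> P"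
proof (rule ccontr)
  interpret P: primeideal P V using P by (simp add: spectrum_def)
  interpret Q: primeideal Q V using Q by (simp add: spectrum_def)
  assume "\<not> (P \<subseteq> Q \<or> Q \<subseteq> P)"
  then obtain a b where a: "a \<in> P" "a \<notin> Q" and b: "b \<in> Q" "b \<notin> P" by blast
  then have "a divides\<^bsub>V\<^esub> b \<or> b divides\<^bsub>V\<^esub> a"
    using V P.Icarr Q.Icarr by (simp add: valuation_ring_def)
  then show False
    using a b P.I_r_closed Q.I_r_closed by (auto simp: factor_def)
qed

text \<open>An open set contains with a prime all smaller primes, and two such subsets of a chain
  are comparable.\<close>

lemma nested_opens_Spec:
  assumes V: "valuation_ring V"
  shows "nested_opens (Spec V)"
  unfolding nested_opens_def
proof (intro allI impI, elim conjE, rule ccontr)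
  fix U W assume "openin (Spec V) U" "openin (Spec V) W" and n: "\<not> (U \<subseteq> W \<or> W \<subseteq> U)"
  then obtain E E' where U: "U = {P \<in> spectrum V. \<not> E \<subseteq> P}" and W: "W = {P \<in> spectrum V. \<not> E' \<subseteq> P}"
    unfolding openin_Spec zariski_open_def by blast
  from n obtain P Q where "P \<in> U" "P \<notin> W" "Q \<in> W" "Q \<notin> U" by blast
  then show False
    using valuation_ring_primes_nested[OF V, of P Q] unfolding U W by blast
qed

text \<open>The closed point is the union of the chain of all prime ideals.\<close>

lemma local_open_topspace_Spec:
  assumes V: "valuation_ring V"
  shows "local_open (Spec V) (topspace (Spec V))"
proof -
  interpret domain V using V by (simp add: valuation_ring_def)
  let ?M = "\<Union>(spectrum V)"
  have id: "ideal P V" "primeideal P V" if "P \<in> spectrum V" for P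
    using that primeideal.axioms(1) by (auto simp: spectrum_def)
  have ne: "{\<zero>\<^bsub>V\<^esub>} \<in> spectrum V" using zeroprimeideal by (simp add: spectrum_def)
  have sub: "?M \<subseteq> carrier V" using id primeideal_subset_carrier by blast
  have "ideal ?M V"
  proof (rule idealI)
    show "ring V" by (rule ring_axioms)
    show "subgroup ?M (add_monoid V)"
    proof (rule add.subgroupI)
      show "?M \<subseteq> carrier V" by fact
      show "?M \<noteq> {}" using ne by blast
      show "\<ominus>\<^bsub>V\<^esub> a \<in> ?M" if "a \<in> ?M" for a
      proof -
        obtain P where P: "P \<in> spectrum V" "a \<in> P" using \<open>a \<in> ?M\<close> by blast
        then show ?thesis
          using additive_subgroup.a_inv_closed[OF ideal.axioms(1)[OF id(1)[OF P(1)]] P(2)] by blast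
      qed
      \<comment> \<open>As the primes form a chain, \<open>a\<close> and \<open>b\<close> lie in a
        common one.\<close>
      show "a \<oplus>\<^bsub>V\<^esub> b \<in> ?M" if ab: "a \<in> ?M" "b \<in> ?M" for a b
      proof -
        obtain P where P: "P \<in> spectrum V" "a \<in> P" "b \<in> P"
          using ab valuation_ring_primes_nested[OF V] by (meson UnionE subsetD)
        then show ?thesis
          using additive_subgroup.a_closed[OF ideal.axioms(1)[OF id(1)[OF P(1)]] P(2,3)] by blast
      qed
    qed
    show "x \<otimes>\<^bsub>V\<^esub> a \<in> ?M" "a \<otimes>\<^bsub>V\<^esub> x \<in> ?M" if ax: "a \<in> ?M" "x \<in> carrier V" for a x
    proof -
      obtain P where P: "P \<in> spectrum V" "a \<in> P" using ax(1) by blast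
      interpret ideal P V using P(1) by (rule id(1))
      show "x \<otimes>\<^bsub>V\<^esub> a \<in> ?M" "a \<otimes>\<^bsub>V\<^esub> x \<in> ?M"
        using P I_l_closed[OF P(2) ax(2)] I_r_closed[OF P(2) ax(2)] by blast+
    qed
  qed
  moreover have "carrier V \<noteq> ?M"
  proof
    assume "carrier V = ?M"
    then obtain P where P: "P \<in> spectrum V" "\<one>\<^bsub>V\<^esub> \<in> P" by blast
    then show False
      using ideal.one_imp_carrier[OF id(1)] primeideal.I_notcarr[OF id(2)] by blast
  qed
  moreover have "a \<in> ?M \<or> b \<in> ?M" if "a \<in> carrier V" "b \<in> carrier V" "a \<otimes>\<^bsub>V\<^esub> b \<in> ?M" for a b
    using that primeideal.I_prime[OF id(2)] by blast
  ultimately have "primeideal ?M V"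
    using is_cring by (intro primeidealI)
  then have M: "?M \<in> spectrum V" by (simp add: spectrum_def)
  \<comment> \<open>A set not contained in the largest prime is not contained in any prime.\<close>
  moreover have "W = spectrum V" if "openin (Spec V) W" "?M \<in> W" for W
  proof -
    from that(1) obtain E where E: "W = {P \<in> spectrum V. \<not> E \<subseteq> P}"
      unfolding openin_Spec zariski_open_def by blast
    then have "\<not> E \<subseteq> P" if "P \<in> spectrum V" for P using \<open>?M \<in> W\<close> that by blast
    then show ?thesis using E by blast
  qed
  ultimately show ?thesis unfolding local_open_def topspace_Spec by blast
qed

section \<open>Finite Krull dimension\<close>

lemma finite_chain_enumeration:
  fixes \<C> :: "'a set set"
  assumes "finite \<C>" "card \<C> = Suc n" "\<And>P Q. \<lbrakk>P \<in> \<C>; Q \<in> \<C>\<rbrakk> \<Longrightarrow> P \<subseteq> Q \<or> Q \<subseteq> P"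
  obtains p :: "nat \<Rightarrow> 'a set" where "\<And>i. i \<le> n \<Longrightarrow> p i \<in> \<C>" "\<And>i. i < n \<Longrightarrow> p i \<subset> p (Suc i)"
proof -
  have "\<exists>p. (\<forall>i\<le>n. p i \<in> \<C>) \<and> (\<forall>i<n. p i \<subset> p (Suc i)) \<and> p n = \<Union>\<C>"
    using assms
  proof (induction n arbitrary: \<C>)
    case 0
    then obtain P where "\<C> = {P}" using card_1_singletonE by (metis One_nat_def)
    then show ?case by (intro exI[of _ "\<lambda>_. P"]) simp
  next
    case (Suc n)
    have "\<C> \<noteq> {}" using Suc.prems(2) by auto
    then have top: "\<Union>\<C> \<in> \<C>"
      using Suc.prems(1,3) by (intro Union_in_chain) (auto simp: subset_chain_def)
    let ?D = "\<C> - {\<Union>\<C>}"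
    have D: "finite ?D" "card ?D = Suc n" using Suc.prems(1,2) top by simp_all
    have "P \<subseteq> Q \<or> Q \<subseteq> P" if "P \<in> ?D" "Q \<in> ?D" for P Q
      using Suc.prems(3) that by simp
    from Suc.IH[OF D this] obtain p where p: "\<forall>i\<le>n. p i \<in> ?D" "\<forall>i<n. p i \<subset> p (Suc i)"
      by metis
    \<comment> \<open>The largest member was removed before the induction hypothesis was applied, so
      it can be appended as a strictly larger last term.\<close>
    have "p n \<subset> \<Union>\<C>" using p(1) by blast
    then show ?case
      using p top by (intro exI[of _ "p(Suc n := \<Union>\<C>)"]) (auto simp: le_Suc_eq less_Suc_eq)
  qed
  then show ?thesis using that by blast
qed

text \<open>Since primes are comparable, any \<open>Suc n\<close> of them can be sorted into a
  strict chain with \<open>n\<close> steps, so an infinite spectrum exceeds every finite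
  dimension.\<close>

lemma finite_spectrum_valuation_ring:
  assumes V: "valuation_ring V" and dim: "krull_dim V < \<infinity>"
  shows "finite (spectrum V)"
proof (rule ccontr)
  assume inf: "infinite (spectrum V)"
  have ge: "enat n \<le> krull_dim V" for n
  proof -
    obtain \<C> where \<C>: "\<C> \<subseteq> spectrum V" "finite \<C>" "card \<C> = Suc n"
      using infinite_arbitrarily_large[OF inf] by blast
    obtain p where "\<And>i. i \<le> n \<Longrightarrow> p i \<in> \<C>" "\<And>i. i < n \<Longrightarrow> p i \<subset> p (Suc i)"
      using finite_chain_enumeration[OF \<C>(2,3)] valuation_ring_primes_nested[OF V] \<C>(1) by blast
    then show ?thesis
      unfolding krull_dim_def using \<C>(1) by (intro Sup_upper) blast
  qed
  obtain m where "krull_dim V = enat m" using dim by (cases "krull_dim V") auto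
  then show False using ge[of "Suc m"] by simp
qed

theorem theorem6p1:
  fixes V :: "('a, 'm) ring_scheme"
    and F :: "('a set, 'b) psh"
    and X :: "'a set topology"
    and Z U :: "'a set set"
  assumes "valuation_ring V"
    and "X = Spec V"
    and "closedin X Z"
    and "U = topspace X - Z"
    and "sheaf X F"
  shows "\<forall>\<epsilon> I d. injective_resolution X F \<epsilon> I d \<longrightarrow>
     (\<forall>\<eta> J e. injective_resolution (subtopology X U) (restrict_psh F U) \<eta> J e \<longrightarrow>
        (\<forall>i>1. local_cohomology X Z I d i \<cong> sheaf_cohomology (subtopology X U) J e (i - 1))) \<and>
     local_cohomology X Z I d 1 \<cong>
       sect F U Mod (res F (topspace X) U ` carrier (sect F (topspace X))) \<and>
     (krull_dim V < \<infinity> \<or> compactin X U \<longrightarrow>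
        (\<forall>i>1. trivial_group (local_cohomology X Z I d i)))"
proof -
  have nested: "nested_opens X" using nested_opens_Spec assms(1,2) by simp
  have top: "local_open X (topspace X)" using local_open_topspace_Spec assms(1,2) by simp
  have U: "openin X U" using assms(3,4) by auto
  have shift: "\<exists>n. i = Suc (Suc n)" if "i > 1" for i :: nat
    using that by presburger
  \<comment> \<open>Finite dimension makes the spectrum finite, and every subset of a finite space
    is compact, so only the quasi-compact case remains.\<close>
  have "compactin X U" if "krull_dim V < \<infinity>"
    using finite_spectrum_valuation_ring[OF assms(1) that] openin_subset[OF U] assms(2)
    by (intro finite_imp_compactin) (auto simp: topspace_Spec intro: finite_subset)
  then have loc: "local_open X U" if "krull_dim V < \<infinity> \<or> compactin X U"
    using that local_open_if_compactin[OF nested] by blast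
  show ?thesis
  proof (intro allI impI conjI)
    fix \<epsilon> I d assume I: "injective_resolution X F \<epsilon> I d"
    note ctx = nested top U assms(4)[symmetric] assms(5) I
    show "local_cohomology X Z I d i \<cong> sheaf_cohomology (subtopology X U) J e (i - 1)"
      if "injective_resolution (subtopology X U) (restrict_psh F U) \<eta> J e" "i > 1" for \<eta> J e i
      using local_cohomology_Suc_Suc_iso[OF ctx that(1)] shift[OF that(2)] by auto
    show "local_cohomology X Z I d 1 \<cong> sect F U Mod (res F (topspace X) U ` carrier (sect F (topspace X)))"
      using local_cohomology_1_iso[OF ctx] by simp
    show "trivial_group (local_cohomology X Z I d i)" if "krull_dim V < \<infinity> \<or> compactin X U" "i > 1" for i
      using local_cohomology_vanishes[OF ctx loc[OF that(1)]] shift[OF that(2)] by auto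
  qed
qed

end
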